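(* Let $\{\mathcal{X},p(y|x),\mathcal{Y}\}$ be a discrete memoryless channel whose input alphabet is the $M$-ASK alphabet $\mathcal{X}=\{-M+1,-M+3,\dots,M-1\}$ with $M=2^{m+1}$, $m\ge 1$. Let $\mathcal{S}=\{-1,+1\}$ and $\mathcal{A}=\{1,3,\dots,M-1\}$. For a probability distribution $p(a)$ on $\mathcal{A}$, let $A\sim p(a)$, let $S$ be uniform on $\mathcal{S}$ and independent of $A$, let $X=SA$, and let $Y$ be the channel output when $X$ is the channel input. Then the rate $$R_{\mathrm{SMD}}^{\gamma>0}=\max_{p(a),\,\gamma:\ H(A)+\gamma\le I(SA;Y)} \big(H(A)+\gamma\big),$$ where $\gamma$ ranges over $0<\gamma<1$ (the maximum being read as a supremum if it is not attained, and the constraint set being assumed nonempty), is achievable with amplitude shaping and modified sign-coding, using symbol-metric decoding (SMD).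
   Context: Conventions. Logarithms are base 2 and entropies are in bits. The output alphabet $\mathcal{Y}$ is discrete and all entropies involved are finite (automatic if $\mathcal{Y}$ is finite). The channel is memoryless: $p(\underline{y}|\underline{x})=\prod_{i=1}^n p(y_i|x_i)$. Underlined letters denote length-$n$ sequences (unless another length is indicated), and $\otimes$ is element-wise multiplication. $I(SA;Y)$ is the mutual information between the pair $(S,A)$ (equivalently $X$) and $Y$. Typical sets. Let $(X_1,\dots,X_k)$ be discrete random variables with joint distribution $p(x_1,\dots,x_k)$, and let $\varepsilon>0$. The weakly jointly typical set $\mathcal{A}^n_\varepsilon(X_1\cdots X_k)$ is the set of tuples $(\underline{x}_1,\dots,\underline{x}_k)$ of length-$n$ sequences such that, for every nonempty $J\subseteq\{1,\dots,k\}$, $\left|-\frac1n\log p(\underline{x}_J)-H(X_J)\right|\le\varepsilon$, where $\underline{x}_J=(\underline{x}_j)_{j\in J}$, $X_J=(X_j)_{j\in J}$, and $p(\underline{x}_J)$ is the $n$-fold product of the marginal distribution of $X_J$. $\mathcal{B}$-typical set. For $p(u,v)=p(u)p(v|u)$, define $$\mathcal{B}^n_{V,\varepsilon}(U)=\Big\{\underline{u}:\ \underline{u}\in\mathcal{A}^n_\varepsilon(U)\ \text{and}\ \Pr\{(\underline{u},\underline{V})\in\mathcal{A}^n_\varepsilon(UV)\mid \underline{U}=\underline{u}\}\ge 1-\varepsilon\Big\},$$ where, given $\underline{U}=\underline{u}$, $\underline{V}$ has distribution $\prod_i p(v_i|u_i)$. $U$ and $V$ may be composite; for instance $\mathcal{B}^n_{SY,\varepsilon}(A)$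 is the case $U=A$, $V=(S,Y)$. Modified sign-coding encoder with SMD. Its parameters are a distribution $p(a)$ on $\mathcal{A}$ (which determines the joint distribution of $(A,S,Y)$ with $S$ uniform and independent of $A$), a number $\gamma\in(0,1)$, a number $\varepsilon>0$, and a blocklength $n$. Put $n_1=\gamma n$ (rounded down to an integer if necessary, with $n_1>0$) and $n_2=n-n_1$. The messages $m_a\in\{1,\dots,M_a\}$ and $m_s\in\{1,\dots,M_s\}$, $M_s=2^{n_1}$, are uniform and independent. A shaping layer maps $m_a$ one-to-one to an amplitude sequence $\underline{a}(m_a)\in\mathcal{B}^n_{SY,\varepsilon}(A)\subseteq\mathcal{A}^n$. The message $m_s$ is mapped bijectively to a sign sequence part $\underline{s}'(m_s)\in\mathcal{S}^{n_1}$. A coding layer assigns to each $(m_a,m_s)$ a second sign sequence part $\underline{s}''(m_a,m_s)\in\mathcal{S}^{n_2}$ (a function of $\underline{a}(m_a)$ and $\underline{s}'(m_s)$). With $\underline{s}(m_a,m_s)=(\underline{s}'(m_s),\underline{s}''(m_a,m_s))$, the transmitted sequence is $\underline{x}(m_a,m_s)=\underline{a}(m_a)\otimes\underline{s}(m_a,m_s)$. SMD. Upon receiving $\underline{y}$, the decoder outputs the unique index pair $(\hat m_a,\hat m_s)$ such that $(\underline{a}(\hat m_a),\underline{s}(\hat m_a,\hat m_s),\underline{y})\in\mathcal{A}^n_\varepsilon(ASY)$; if there is no such unique pair, an error is declared. The error probability is $P_e=\Pr\{(\hat m_a,\hat m_s)\ne(m_a,m_s)\}$. Achievability. A rate $R$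 is achievable (with modified sign-coding, using SMD) if for every $\delta>0$ and all $n$ large enough there exists a modified sign-coding encoder of blocklength $n$ (that is, a distribution $p(a)$ on $\mathcal{A}$, numbers $\gamma\in(0,1)$ and $\varepsilon>0$, an integer $M_a\ge 1$ and $M_s=2^{n_1}$, a one-to-one map $m_a\mapsto\underline{a}(m_a)\in\mathcal{B}^n_{SY,\varepsilon}(A)$, a bijection $m_s\mapsto\underline{s}'(m_s)\in\mathcal{S}^{n_1}$, and sign sequence parts $\underline{s}''(m_a,m_s)\in\mathcal{S}^{n_2}$) such that, when $\underline{x}(m_a,m_s)=\underline{a}(m_a)\otimes\underline{s}(m_a,m_s)$ is transmitted and the decoder is the SMD decoder that outputs the unique $(\hat m_a,\hat m_s)$ with $(\underline{a}(\hat m_a),\underline{s}(\hat m_a,\hat m_s),\underline{y})\in\mathcal{A}^n_\varepsilon(ASY)$ for the same $p(a)$ and $\varepsilon$, one has $\frac1n\log_2(M_aM_s)\ge R-\delta$ and $P_e\le\delta$. *)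

theory Defs
  imports "HOL-Probability.Probability"
begin

section \<open>Information measures of discrete distributions, in bits\<close>

text \<open>A distribution on a discrete alphabet is a \<^typ>\<open>'a pmf\<close>; alphabets are countable types, so
  that \<^term>\<open>count_space UNIV\<close> is a \<open>\<sigma>\<close>-finite reference measure, also on products.\<close>

definition pmf_entropy :: "'a pmf \<Rightarrow> real" where
  "pmf_entropy p = prob_space.entropy (measure_pmf p) 2 (count_space UNIV) (\<lambda>x. x)"

definition pmf_finite_entropy :: "'a pmf \<Rightarrow> bool" where
  "pmf_finite_entropy p \<longleftrightarrow>
     information_space.finite_entropy (measure_pmf p) 2 (count_space UNIV) (\<lambda>x. x) (pmf p)"

definition pmf_mutual_info :: "'w pmf \<Rightarrow> ('w \<Rightarrow> 'a) \<Rightarrow> ('w \<Rightarrow> 'b) \<Rightarrow> real" where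
  "pmf_mutual_info P X Y =
     prob_space.mutual_information (measure_pmf P) 2 (count_space UNIV) (count_space UNIV) X Y"

lemma information_space_pmf: "information_space (measure_pmf p) 2"
  by (intro information_space.intro measure_pmf.prob_space_axioms information_space_axioms.intro) simp

lemma distributed_pmf:
  "distributed (measure_pmf p) (count_space UNIV) (\<lambda>x. x) (pmf p)"
proof -
  have "distr (measure_pmf p) (count_space UNIV) (\<lambda>x. x) = measure_pmf p"
    by (rule distr_id2) simp
  then show ?thesis
    by (simp add: distributed_def measure_pmf_eq_density[symmetric])
qed

lemma pmf_entropy_eq:
  fixes p :: "'a :: countable pmf"
  shows "pmf_entropy p = - (\<integral>x. pmf p x * log 2 (pmf p x) \<partial>count_space UNIV)"
proof -
  interpret information_space "measure_pmf p" 2 by (rule information_space_pmf)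
  interpret C: sigma_finite_measure "count_space (UNIV :: 'a set)"
    by (rule sigma_finite_measure_count_space)
  show ?thesis
    unfolding pmf_entropy_def
    by (rule entropy_distr[OF distributed_pmf]) simp
qed

lemma pmf_finite_entropy_iff:
  "pmf_finite_entropy p \<longleftrightarrow>
     integrable (count_space UNIV) (\<lambda>x. pmf p x * log 2 (pmf p x))"
  unfolding pmf_finite_entropy_def information_space.finite_entropy_def[OF information_space_pmf]
  by (simp add: distributed_pmf)


section \<open>Sequences and weak typicality\<close>

text \<open>A length-\<open>n\<close> sequence is a list of length \<open>n\<close>.\<close>

definition seqs :: "nat \<Rightarrow> 'a set \<Rightarrow> 'a list set" where
  "seqs n A = {xs. length xs = n \<and> set xs \<subseteq> A}"

text \<open>The memoryless extension of a transition kernel: given the sequence \<open>xs\<close>, the output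
  letters are independent, the \<open>i\<close>-th with distribution \<open>W (xs ! i)\<close>.\<close>

definition memoryless :: "('x \<Rightarrow> 'y pmf) \<Rightarrow> 'x list \<Rightarrow> 'y list pmf" where
  "memoryless W xs =
     map_pmf (\<lambda>f. map f [0..<length xs])
       (Pi_pmf {..<length xs} undefined (\<lambda>i. W (xs ! i)))"

lemma pmf_memoryless:
  "pmf (memoryless W xs) ys =
     (if length ys = length xs then \<Prod>i<length xs. pmf (W (xs ! i)) (ys ! i) else 0)"
proof (cases "length ys = length xs")
  case True
  define g where "g i = (if i < length xs then ys ! i else undefined)" for i
  define P where "P = Pi_pmf {..<length xs} undefined (\<lambda>i. W (xs ! i))"
  have "f = g" if "f \<in> set_pmf P" "map f [0..<length xs] = ys" for f
  proof
    fix i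
    have "f i = undefined" if "\<not> i < length xs"
      using set_Pi_pmf_subset[of "{..<length xs}" undefined "\<lambda>i. W (xs ! i)"] that
        \<open>f \<in> set_pmf P\<close> by (auto simp: P_def)
    then show "f i = g i"
      using \<open>map f [0..<length xs] = ys\<close> by (auto simp: g_def)
  qed
  moreover have "map g [0..<length xs] = ys"
    using True by (intro nth_equalityI) (auto simp: g_def)
  ultimately have "pmf (memoryless W xs) ys = measure_pmf.prob P {g}"
    unfolding memoryless_def pmf_map P_def[symmetric]
    by (intro measure_prob_cong_0) (auto simp: set_pmf_eq)
  also have "\<dots> = (\<Prod>i<length xs. pmf (W (xs ! i)) (ys ! i))"
    unfolding measure_pmf_single P_def by (subst pmf_Pi) (auto simp: g_def)
  finally show ?thesis using True by simp
next
  case False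
  then have "ys \<notin> set_pmf (memoryless W xs)" by (auto simp: memoryless_def)
  then show ?thesis using False by (simp add: set_pmf_eq)
qed

text \<open>The single condition \<open>\<bar>- 1/n log p(z) - H(Z)\<bar> \<le> \<epsilon>\<close>. Positivity of \<open>p(z)\<close> is required
  explicitly since HOL has \<open>log 2 0 = 0\<close>, whereas the left-hand side is infinite for \<open>p(z) = 0\<close>.\<close>

definition entropy_typical :: "nat \<Rightarrow> real \<Rightarrow> 'z pmf \<Rightarrow> 'z list \<Rightarrow> bool" where
  "entropy_typical n \<epsilon> p z \<longleftrightarrow>
     length z = n \<and> (\<Prod>i<n. pmf p (z ! i)) > 0 \<and>
     \<bar>- (1 / real n) * log 2 (\<Prod>i<n. pmf p (z ! i)) - pmf_entropy p\<bar> \<le> \<epsilon>"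

definition typical1 :: "nat \<Rightarrow> real \<Rightarrow> 'u pmf \<Rightarrow> 'u list set" where
  "typical1 n \<epsilon> p = {u. entropy_typical n \<epsilon> p u}"

text \<open>Joint typicality of three sequences, one condition for each nonempty subset of the
  coordinates.\<close>

definition typical3 ::
  "nat \<Rightarrow> real \<Rightarrow> ('a \<times> 'b \<times> 'c) pmf \<Rightarrow> ('a list \<times> 'b list \<times> 'c list) set" where
  "typical3 n \<epsilon> P = {(a, b, c).
     length a = n \<and> length b = n \<and> length c = n \<and>
     entropy_typical n \<epsilon> (map_pmf (\<lambda>(x, y, z). x) P) a \<and>
     entropy_typical n \<epsilon> (map_pmf (\<lambda>(x, y, z). y) P) b \<and>
     entropy_typical n \<epsilon> (map_pmf (\<lambda>(x, y, z). z) P) c \<and>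
     entropy_typical n \<epsilon> (map_pmf (\<lambda>(x, y, z). (x, y)) P) (zip a b) \<and>
     entropy_typical n \<epsilon> (map_pmf (\<lambda>(x, y, z). (x, z)) P) (zip a c) \<and>
     entropy_typical n \<epsilon> (map_pmf (\<lambda>(x, y, z). (y, z)) P) (zip b c) \<and>
     entropy_typical n \<epsilon> P (zip a (zip b c))}"

definition joint_pmf :: "'u pmf \<Rightarrow> ('u \<Rightarrow> 'v pmf) \<Rightarrow> ('u \<times> 'v) pmf" where
  "joint_pmf p K = do {u \<leftarrow> p; v \<leftarrow> K u; return_pmf (u, v)}"

text \<open>The set \<open>\<B>\<^sup>n\<^bsub>V,\<epsilon>\<^esub>(U)\<close> for a composite \<open>V = (V\<^sub>1, V\<^sub>2)\<close>, where \<open>p\<close> is the distribution of \<open>U\<close>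
  and \<open>K u\<close> the conditional distribution of \<open>V\<close> given \<open>U = u\<close>. Joint typicality of \<open>(U, V)\<close> is
  that of the triple \<open>(U, V\<^sub>1, V\<^sub>2)\<close>.\<close>

definition B_typical :: "nat \<Rightarrow> real \<Rightarrow> 'u pmf \<Rightarrow> ('u \<Rightarrow> ('v \<times> 'w) pmf) \<Rightarrow> 'u list set" where
  "B_typical n \<epsilon> p K = {u \<in> typical1 n \<epsilon> p.
     measure_pmf.prob (memoryless K u)
       {vw. (u, map fst vw, map snd vw) \<in> typical3 n \<epsilon> (joint_pmf p K)} \<ge> 1 - \<epsilon>}"


section \<open>Amplitudes, signs and the channel\<close>

definition ask :: "int \<Rightarrow> int set" where
  "ask M = {- M + 1 + 2 * k | k. 0 \<le> k \<and> k < M}"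

definition amplitudes :: "int \<Rightarrow> int set" where
  "amplitudes M = {a. odd a \<and> 1 \<le> a \<and> a \<le> M - 1}"

definition signs :: "int set" where
  "signs = {- 1, 1}"

lemma ask_eq_signed_amplitudes:
  assumes "even M"
  shows "ask M = (\<lambda>(s, a). s * a) ` (signs \<times> amplitudes M)"
proof -
  have "x \<in> ask M \<longleftrightarrow> odd x \<and> \<bar>x\<bar> \<le> M - 1" for x
  proof
    assume "odd x \<and> \<bar>x\<bar> \<le> M - 1"
    moreover from this assms obtain k where "x + M - 1 = 2 * k"
      by (metis evenE even_add odd_one even_diff)
    ultimately show "x \<in> ask M" unfolding ask_def by (auto intro!: exI[of _ k])
  qed (use assms in \<open>auto simp: ask_def\<close>)
  moreover have "x \<in> (\<lambda>(s, a). s * a) ` (signs \<times> amplitudes M) \<longleftrightarrow> odd x \<and> \<bar>x\<bar> \<le> M - 1" for x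
  proof
    assume x: "odd x \<and> \<bar>x\<bar> \<le> M - 1"
    then have "x \<noteq> 0" by auto
    with x show "x \<in> (\<lambda>(s, a). s * a) ` (signs \<times> amplitudes M)"
      by (intro image_eqI[of _ _ "(sgn x, \<bar>x\<bar>)"])
        (auto simp: signs_def amplitudes_def sgn_if)
  qed (auto simp: signs_def amplitudes_def)
  ultimately show ?thesis by blast
qed

text \<open>The channel is a kernel \<open>W\<close> with \<open>W x = p(\<cdot>|x)\<close>; only its values on \<^term>\<open>ask M\<close> matter.
  The first function gives the conditional distribution of \<open>(S, Y)\<close> given \<open>A = a\<close>, the second the
  joint distribution of \<open>(A, S, Y)\<close>.\<close>

definition sy_given :: "(int \<Rightarrow> 'y pmf) \<Rightarrow> int \<Rightarrow> (int \<times> 'y) pmf" where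
  "sy_given W a = do {s \<leftarrow> pmf_of_set signs; y \<leftarrow> W (s * a); return_pmf (s, y)}"

definition asy_pmf :: "(int \<Rightarrow> 'y pmf) \<Rightarrow> int pmf \<Rightarrow> (int \<times> int \<times> 'y) pmf" where
  "asy_pmf W p = joint_pmf p (sy_given W)"

definition info_SA_Y :: "(int \<Rightarrow> 'y pmf) \<Rightarrow> int pmf \<Rightarrow> real" where
  "info_SA_Y W p = pmf_mutual_info (asy_pmf W p) (\<lambda>(a, s, y). (s, a)) (\<lambda>(a, s, y). y)"


section \<open>Modified sign-coding\<close>

record sc_encoder =
  amp_pmf :: "int pmf"
  sgn_frac :: real                              \<comment> \<open>\<open>\<gamma>\<close>\<close>
  tol :: real                                   \<comment> \<open>\<open>\<epsilon>\<close>\<close>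
  num_amp :: nat                                \<comment> \<open>\<open>M\<^sub>a\<close>\<close>
  amp_seq :: "nat \<Rightarrow> int list"                  \<comment> \<open>\<open>m\<^sub>a \<mapsto> a\<close>\<close>
  sgn_info :: "nat \<Rightarrow> int list"                 \<comment> \<open>\<open>m\<^sub>s \<mapsto> s'\<close>\<close>
  sgn_code :: "nat \<Rightarrow> nat \<Rightarrow> int list"          \<comment> \<open>\<open>(m\<^sub>a, m\<^sub>s) \<mapsto> s''\<close>\<close>

definition info_len :: "nat \<Rightarrow> sc_encoder \<Rightarrow> nat" where
  "info_len n E = nat \<lfloor>sgn_frac E * real n\<rfloor>"

definition num_sgn :: "nat \<Rightarrow> sc_encoder \<Rightarrow> nat" where
  "num_sgn n E = 2 ^ info_len n E"

definition messages :: "nat \<Rightarrow> sc_encoder \<Rightarrow> (nat \<times> nat) set" where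
  "messages n E = {1..num_amp E} \<times> {1..num_sgn n E}"

definition valid_encoder :: "int \<Rightarrow> (int \<Rightarrow> 'y pmf) \<Rightarrow> nat \<Rightarrow> sc_encoder \<Rightarrow> bool" where
  "valid_encoder M W n E \<longleftrightarrow>
     set_pmf (amp_pmf E) \<subseteq> amplitudes M \<and>
     0 < sgn_frac E \<and> sgn_frac E < 1 \<and> 0 < tol E \<and> 0 < info_len n E \<and> 1 \<le> num_amp E \<and>
     inj_on (amp_seq E) {1..num_amp E} \<and>
     amp_seq E ` {1..num_amp E} \<subseteq>
       B_typical n (tol E) (amp_pmf E) (sy_given W) \<inter> seqs n (amplitudes M) \<and>
     bij_betw (sgn_info E) {1..num_sgn n E} (seqs (info_len n E) signs) \<and>
     (\<forall>(ma, ms) \<in> messages n E. sgn_code E ma ms \<in> seqs (n - info_len n E) signs)"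

definition sgn_seq :: "sc_encoder \<Rightarrow> nat \<Rightarrow> nat \<Rightarrow> int list" where
  "sgn_seq E ma ms = sgn_info E ms @ sgn_code E ma ms"

definition codeword :: "sc_encoder \<Rightarrow> nat \<Rightarrow> nat \<Rightarrow> int list" where
  "codeword E ma ms = map2 (*) (amp_seq E ma) (sgn_seq E ma ms)"

definition smd_candidates ::
  "(int \<Rightarrow> 'y pmf) \<Rightarrow> nat \<Rightarrow> sc_encoder \<Rightarrow> 'y list \<Rightarrow> (nat \<times> nat) set" where
  "smd_candidates W n E y =
     {(ma, ms) \<in> messages n E.
        (amp_seq E ma, sgn_seq E ma ms, y) \<in> typical3 n (tol E) (asy_pmf W (amp_pmf E))}"

definition smd_decode ::
  "(int \<Rightarrow> 'y pmf) \<Rightarrow> nat \<Rightarrow> sc_encoder \<Rightarrow> 'y list \<Rightarrow> (nat \<times> nat) option" where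
  "smd_decode W n E y =
     (if \<exists>!mm. mm \<in> smd_candidates W n E y
      then Some (THE mm. mm \<in> smd_candidates W n E y) else None)"

definition error_prob :: "(int \<Rightarrow> 'y pmf) \<Rightarrow> nat \<Rightarrow> sc_encoder \<Rightarrow> real" where
  "error_prob W n E =
     measure_pmf.prob
       (do {(ma, ms) \<leftarrow> pmf_of_set (messages n E);
            y \<leftarrow> memoryless W (codeword E ma ms);
            return_pmf ((ma, ms), smd_decode W n E y)})
       {(mm, d). d \<noteq> Some mm}"

definition achievable_smd :: "int \<Rightarrow> (int \<Rightarrow> 'y pmf) \<Rightarrow> real \<Rightarrow> bool" where
  "achievable_smd M W R \<longleftrightarrow>
     (\<forall>\<delta>>0. \<forall>\<^sub>F n in sequentially. \<exists>E. valid_encoder M W n E \<and>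
        (1 / real n) * log 2 (real (num_amp E * num_sgn n E)) \<ge> R - \<delta> \<and>
        error_prob W n E \<le> \<delta>)"

definition feasible :: "int \<Rightarrow> (int \<Rightarrow> 'y pmf) \<Rightarrow> (int pmf \<times> real) set" where
  "feasible M W = {(p, \<gamma>). set_pmf p \<subseteq> amplitudes M \<and> 0 < \<gamma> \<and> \<gamma> < 1 \<and>
     pmf_entropy p + \<gamma> \<le> info_SA_Y W p}"

definition R_SMD :: "int \<Rightarrow> (int \<Rightarrow> 'y pmf) \<Rightarrow> real" where
  "R_SMD M W = (SUP (p, \<gamma>) \<in> feasible M W. pmf_entropy p + \<gamma>)"

text \<open>The supremum is taken over a bounded set, as required for \<^const>\<open>Sup\<close> on the reals.\<close>

lemma bdd_above_rates: "bdd_above ((\<lambda>(p, \<gamma>). pmf_entropy p + \<gamma>) ` feasible M W)"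
proof (rule bdd_aboveI2)
  fix q assume q: "q \<in> feasible M W"
  obtain p \<gamma> where [simp]: "q = (p, \<gamma>)" by (cases q)
  have p: "set_pmf p \<subseteq> amplitudes M" and "\<gamma> < 1" using q by (auto simp: feasible_def)
  have fin: "finite (amplitudes M)"
    by (rule finite_subset[of _ "{1..M}"]) (auto simp: amplitudes_def)
  have "pmf_entropy p = - (\<Sum>a\<in>amplitudes M. pmf p a * log 2 (pmf p a))"
    unfolding pmf_entropy_eq
    by (subst lebesgue_integral_count_space_finite_support)
      (use p fin in \<open>auto simp: set_pmf_eq intro!: sum.mono_neutral_left finite_subset[OF _ fin]\<close>)
  also have "\<dots> = (\<Sum>a\<in>amplitudes M. - (pmf p a * log 2 (pmf p a)))"
    by (simp add: sum_negf)
  also have "\<dots> \<le> (\<Sum>a\<in>amplitudes M. 1 / ln 2)"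
  proof (rule sum_mono)
    fix a
    show "- (pmf p a * log 2 (pmf p a)) \<le> 1 / ln 2"
    proof (cases "pmf p a = 0")
      case False
      then have pos: "pmf p a > 0" by (simp add: pmf_pos)
      have "pmf p a * ln (1 / pmf p a) \<le> pmf p a * (1 / pmf p a - 1)"
        using pos by (intro mult_left_mono ln_le_minus_one) auto
      also have "\<dots> \<le> 1" using pos by (simp add: algebra_simps)
      finally have "- (pmf p a * ln (pmf p a)) \<le> 1" using pos by (simp add: ln_div)
      then show ?thesis by (simp add: log_def field_simps)
    qed simp
  qed
  finally show "(case q of (p, \<gamma>) \<Rightarrow> pmf_entropy p + \<gamma>) \<le> card (amplitudes M) * (1 / ln 2) + 1"
    using \<open>\<gamma> < 1\<close> by simp
qed

end

theory Submission
  imports Defs "HOL-Real_Asymp.Real_Asymp"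
begin

text \<open>Take all of the \<open>\<B>\<close>-typical set as amplitude sequences and choose the sign parts \<open>s''\<close>
  uniformly at random. For a message pair, the true triple fails to be typical with probability at
  most \<open>\<epsilon>\<close> on average, by definition of the \<open>\<B>\<close>-typical set. Given \<open>y\<close>, there are at most
  \<open>2 powr (n (H(ASY) - H(Y) + 2\<epsilon>))\<close> pairs \<open>(a, s)\<close> typical with \<open>y\<close>, and each competing message
  hits a given one of its \<open>2 ^ n\<^sub>2\<close> possible sign parts with probability \<open>1 / 2 ^ n\<^sub>2\<close>; the sum over
  all competitors is therefore small as soon as \<open>H(ASY) - H(Y) + 2\<epsilon> < 1 - \<gamma>\<close>. Since
  \<open>I(SA;Y) = H(A) + 1 + H(Y) - H(ASY)\<close>, this holds after lowering a feasible \<open>\<gamma>\<close> by \<open>3\<epsilon>\<close>. The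
  output alphabet may be infinite with \<open>log p\<close> of infinite variance, so typicality rests on a weak
  law of large numbers for merely integrable variables, obtained by truncation.\<close>

section \<open>The weak law of large numbers\<close>

lemma integrable_pmf_bounded:
  fixes f :: "'a \<Rightarrow> real"
  assumes "\<And>x. \<bar>f x\<bar> \<le> B"
  shows "integrable (measure_pmf p) f"
  by (rule measure_pmf.integrable_const_bound[where B = B]) (use assms in auto)

text \<open>The bound is asked for on the support only, because sums over lists are bounded only
  once the length is fixed. Clipping to \<open>g\<close> leaves \<open>f\<close> unchanged on the
  support and makes the bound global.\<close>

lemma integral_bind_pmf_bounded:
  fixes f :: "'b \<Rightarrow> real"
  assumes "\<And>x. x \<in> set_pmf (bind_pmf p K) \<Longrightarrow> \<bar>f x\<bar> \<le> B"
  shows "measure_pmf.expectation (bind_pmf p K) f =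
         measure_pmf.expectation p (\<lambda>x. measure_pmf.expectation (K x) f)"
proof -
  define g where "g x = max (- B) (min B (f x))" for x
  have eq: "g x = f x" if "x \<in> set_pmf (bind_pmf p K)" for x
    using assms[OF that] by (auto simp: g_def)
  have "measure_pmf.expectation (bind_pmf p K) f = measure_pmf.expectation (bind_pmf p K) g"
    by (intro integral_cong_AE) (use eq in \<open>auto simp: AE_measure_pmf_iff\<close>)
  also have "\<dots> = measure_pmf.expectation p (\<lambda>x. measure_pmf.expectation (K x) g)"
    unfolding measure_pmf_bind
    by (intro integral_bind[where K = "count_space UNIV" and B = "\<bar>B\<bar>" and B' = 1])
      (auto simp: g_def emeasure_pmf measure_pmf.finite_measure measure_pmf_in_subprob_algebra
        intro!: AE_I2)
  also have "\<dots> = measure_pmf.expectation p (\<lambda>x. measure_pmf.expectation (K x) f)"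
    by (intro integral_cong_AE AE_pmfI) (use eq in \<open>auto simp: AE_measure_pmf_iff\<close>)
  finally show ?thesis .
qed

lemma prob_bind_pmf:
  "measure_pmf.prob (bind_pmf p K) A = measure_pmf.expectation p (\<lambda>x. measure_pmf.prob (K x) A)"
  using integral_bind_pmf_bounded[of p K "indicator A" 1] by (simp add: indicator_def)

lemma expectation_pmf_mono:
  fixes f g :: "'a \<Rightarrow> real"
  assumes "integrable (measure_pmf p) f" "integrable (measure_pmf p) g"
    and "\<And>x. x \<in> set_pmf p \<Longrightarrow> f x \<le> g x"
  shows "measure_pmf.expectation p f \<le> measure_pmf.expectation p g"
  by (intro integral_mono_AE AE_pmfI assms)

lemma integrable_prob_pmf [simp]:
  "integrable (measure_pmf p) (\<lambda>x. measure_pmf.prob (K x) (A x))"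
  by (rule integrable_pmf_bounded[of _ 1]) simp

lemma length_replicate_pmf: "z \<in> set_pmf (replicate_pmf n p) \<Longrightarrow> length z = n"
  by (simp add: set_replicate_pmf)

text \<open>Variances of independent centred letters add. Both claims go through one induction:
  expanding the square produces a cross term \<open>2 * g x * sum_list (map g z)\<close>, and the
  second claim makes its mean vanish.\<close>

lemma expectation_replicate_sum_square:
  fixes g :: "'a \<Rightarrow> real"
  assumes B: "\<And>x. \<bar>g x\<bar> \<le> B" and mean: "measure_pmf.expectation p g = 0"
  shows "measure_pmf.expectation (replicate_pmf n p) (\<lambda>z. (sum_list (map g z))\<^sup>2) =
    real n * measure_pmf.expectation p (\<lambda>x. (g x)\<^sup>2)"
    and "measure_pmf.expectation (replicate_pmf n p) (\<lambda>z. sum_list (map g z)) = 0"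
proof (induction n)
  case (Suc n)
  have B0: "0 \<le> B" using B[of undefined] by linarith
  have sum_le: "\<bar>sum_list (map g z)\<bar> \<le> real (length z) * B" for z
  proof (induction z)
    case (Cons a z)
    then show ?case using B[of a] by (simp add: algebra_simps)
  qed simp
  have sq_le: "\<bar>(sum_list (map g z))\<^sup>2\<bar> \<le> (real (length z) * B)\<^sup>2" for z
    using power_mono[OF sum_le[of z], of 2] by simp
  have [simp]: "integrable (measure_pmf (replicate_pmf n p)) (\<lambda>z. sum_list (map g z))"
    by (rule measure_pmf.integrable_const_bound[where B = "real n * B"])
      (use sum_le in \<open>auto intro!: AE_pmfI dest: length_replicate_pmf\<close>)
  have [simp]: "integrable (measure_pmf (replicate_pmf n p)) (\<lambda>z. (sum_list (map g z))\<^sup>2)"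
    by (rule measure_pmf.integrable_const_bound[where B = "(real n * B)\<^sup>2"])
      (use sq_le in \<open>auto intro!: AE_pmfI dest!: length_replicate_pmf\<close>)
  have [simp]: "integrable (measure_pmf p) g" by (rule integrable_pmf_bounded) (rule B)
  have [simp]: "integrable (measure_pmf p) (\<lambda>x. (g x)\<^sup>2)"
    by (rule integrable_pmf_bounded[of _ "B\<^sup>2"]) (use B B0 in \<open>simp add: abs_le_square_iff[symmetric]\<close>)
  {
    have "measure_pmf.expectation (replicate_pmf (Suc n) p) (\<lambda>z. (sum_list (map g z))\<^sup>2) =
        measure_pmf.expectation p (\<lambda>x. measure_pmf.expectation (replicate_pmf n p)
          (\<lambda>z. (g x + sum_list (map g z))\<^sup>2))"
      unfolding replicate_pmf.simps
      apply (subst integral_bind_pmf_bounded[where B = "(real (Suc n) * B)\<^sup>2"])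
      subgoal for z using sq_le[of z] length_replicate_pmf[of z "Suc n" p] by simp
      apply (simp only: map_pmf_def[symmetric] integral_map_pmf list.map sum_list.Cons)
      done
    also have "\<dots> = measure_pmf.expectation p (\<lambda>x. (g x)\<^sup>2
        + real n * measure_pmf.expectation p (\<lambda>x. (g x)\<^sup>2))"
      by (simp add: power2_sum Suc.IH)
    also have "\<dots> = real (Suc n) * measure_pmf.expectation p (\<lambda>x. (g x)\<^sup>2)"
      by (simp add: algebra_simps)
    finally show "measure_pmf.expectation (replicate_pmf (Suc n) p) (\<lambda>z. (sum_list (map g z))\<^sup>2) =
        real (Suc n) * measure_pmf.expectation p (\<lambda>x. (g x)\<^sup>2)" .
  next
    have "measure_pmf.expectation (replicate_pmf (Suc n) p) (\<lambda>z. sum_list (map g z)) =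
        measure_pmf.expectation p (\<lambda>x. measure_pmf.expectation (replicate_pmf n p)
          (\<lambda>z. g x + sum_list (map g z)))"
      unfolding replicate_pmf.simps
      apply (subst integral_bind_pmf_bounded[where B = "real (Suc n) * B"])
      subgoal for z using sum_le[of z] length_replicate_pmf[of z "Suc n" p] by simp
      apply (simp only: map_pmf_def[symmetric] integral_map_pmf list.map sum_list.Cons)
      done
    also have "\<dots> = 0" by (simp add: Suc.IH mean)
    finally show "measure_pmf.expectation (replicate_pmf (Suc n) p) (\<lambda>z. sum_list (map g z)) = 0" .
  }
qed simp_all

text \<open>With extended nonnegative integrals the induction needs no integrability. Finiteness of
  the right-hand side then yields integrability of the sum and its mean at once.\<close>

lemma nn_integral_replicate_sum:
  fixes g :: "'a \<Rightarrow> real"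
  assumes "\<And>x. 0 \<le> g x"
  shows "(\<integral>\<^sup>+z. ennreal (sum_list (map g z)) \<partial>replicate_pmf n p) =
    ennreal (real n) * (\<integral>\<^sup>+x. ennreal (g x) \<partial>p)"
proof (induction n)
  case (Suc n)
  have [simp]: "0 \<le> sum_list (map g z)" for z by (intro sum_list_nonneg) (use assms in auto)
  have "(\<integral>\<^sup>+z. ennreal (sum_list (map g z)) \<partial>replicate_pmf (Suc n) p) =
      (\<integral>\<^sup>+x. \<integral>\<^sup>+z. ennreal (g x) + ennreal (sum_list (map g z)) \<partial>replicate_pmf n p \<partial>p)"
    by (simp add: ennreal_plus[symmetric] assms del: ennreal_plus)
  also have "\<dots> = (\<integral>\<^sup>+x. ennreal (g x) + ennreal (real n) * (\<integral>\<^sup>+x. ennreal (g x) \<partial>p) \<partial>p)"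
    by (simp add: nn_integral_add Suc.IH)
  also have "\<dots> = ennreal (real (Suc n)) * (\<integral>\<^sup>+x. ennreal (g x) \<partial>p)"
    by (simp add: nn_integral_add distrib_right add.commute)
  finally show ?case .
qed simp

lemma expectation_replicate_sum:
  fixes g :: "'a \<Rightarrow> real"
  assumes "\<And>x. 0 \<le> g x" and int: "integrable (measure_pmf p) g"
  shows "integrable (measure_pmf (replicate_pmf n p)) (\<lambda>z. sum_list (map g z))"
    and "measure_pmf.expectation (replicate_pmf n p) (\<lambda>z. sum_list (map g z)) =
      real n * measure_pmf.expectation p g"
proof -
  have nn: "0 \<le> sum_list (map g z)" for z by (intro sum_list_nonneg) (use assms in auto)
  have E0: "0 \<le> measure_pmf.expectation p g" by (simp add: assms(1))
  have "(\<integral>\<^sup>+z. ennreal (sum_list (map g z)) \<partial>replicate_pmf n p) =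
      ennreal (real n * measure_pmf.expectation p g)"
    using nn_integral_replicate_sum[of g n p] assms
    by (simp add: nn_integral_eq_integral ennreal_mult E0)
  then show "integrable (measure_pmf (replicate_pmf n p)) (\<lambda>z. sum_list (map g z))"
    and "measure_pmf.expectation (replicate_pmf n p) (\<lambda>z. sum_list (map g z)) =
      real n * measure_pmf.expectation p g"
    using nn E0 by (auto simp: nn_integral_eq_integrable)
qed

text \<open>Dominated convergence with majorant \<open>\<bar>f x\<bar>\<close>: for each fixed
  \<open>x\<close> the integrand is zero as soon as \<open>k\<close> exceeds
  \<open>\<bar>f x\<bar>\<close>.\<close>

lemma truncation_tail_tendsto_0:
  fixes f :: "'a \<Rightarrow> real"
  assumes "integrable (measure_pmf p) f"
  shows "(\<lambda>k. measure_pmf.expectation p (\<lambda>x. if \<bar>f x\<bar> \<le> real k then 0 else \<bar>f x\<bar>)) \<longlonglongrightarrow> 0"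
proof -
  have "(\<lambda>k. measure_pmf.expectation p (\<lambda>x. if \<bar>f x\<bar> \<le> real k then 0 else \<bar>f x\<bar>))
      \<longlonglongrightarrow> measure_pmf.expectation p (\<lambda>x. 0)"
  proof (rule integral_dominated_convergence[where w = "\<lambda>x. \<bar>f x\<bar>"])
    show "AE x in measure_pmf p. (\<lambda>k. if \<bar>f x\<bar> \<le> real k then 0 else \<bar>f x\<bar>) \<longlonglongrightarrow> 0"
    proof (intro AE_pmfI tendsto_eventually)
      fix x
      show "\<forall>\<^sub>F k in sequentially. (if \<bar>f x\<bar> \<le> real k then 0 else \<bar>f x\<bar>) = 0"
        using eventually_ge_at_top[of "nat \<lceil>\<bar>f x\<bar>\<rceil>"]
        by eventually_elim (simp add: nat_ceiling_le_eq)
    qed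
  qed (use assms in auto)
  then show ?thesis by simp
qed

lemma prob_mono_set_pmf:
  assumes "\<And>x. x \<in> set_pmf p \<Longrightarrow> x \<in> A \<Longrightarrow> x \<in> B"
  shows "measure_pmf.prob p A \<le> measure_pmf.prob p B"
  by (rule measure_pmf.finite_measure_mono_AE) (use assms in \<open>auto intro!: AE_pmfI\<close>)

text \<open>The deviation has three sources, each allotted a third of \<epsilon>: the centred
  truncated sum, bounded and so controlled by Chebyshev; the sum of the tails \<open>r\<close>, of
  small mean and so controlled by Markov; and the shift between the means of \<open>f\<close> and of
  its truncation \<open>t\<close>.\<close>

theorem weak_law_of_large_numbers:
  fixes f :: "'a \<Rightarrow> real"
  assumes int: "integrable (measure_pmf p) f" and \<epsilon>: "\<epsilon> > 0"
  shows "(\<lambda>n. measure_pmf.prob (replicate_pmf n p)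
    {z. \<bar>sum_list (map f z) / real n - measure_pmf.expectation p f\<bar> > \<epsilon>}) \<longlonglongrightarrow> 0"
proof (rule tendstoI)
  fix \<delta> :: real assume \<delta>: "\<delta> > 0"
  \<comment> \<open>The first bound keeps the shift of the mean below \<epsilon>/3; the second turns
    the Markov bound \<open>3 * \<eta> / \<epsilon>\<close> for the tails into at most
    \<delta>/2.\<close>
  define \<eta> where "\<eta> = min (\<epsilon> / 3) (\<epsilon> * \<delta> / 6)"
  have \<eta>: "\<eta> > 0" "\<eta> \<le> \<epsilon> / 3" "\<eta> \<le> \<epsilon> * \<delta> / 6" using \<epsilon> \<delta> by (auto simp: \<eta>_def)
  have "\<forall>\<^sub>F k in sequentially.
      measure_pmf.expectation p (\<lambda>x. if \<bar>f x\<bar> \<le> real k then 0 else \<bar>f x\<bar>) < \<eta>"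
    by (rule order_tendstoD(2)[OF truncation_tail_tendsto_0[OF int] \<eta>(1)])
  then obtain k where k:
    "measure_pmf.expectation p (\<lambda>x. if \<bar>f x\<bar> \<le> real k then 0 else \<bar>f x\<bar>) < \<eta>"
    by (auto simp: eventually_sequentially)
  define r where "r x = (if \<bar>f x\<bar> \<le> real k then 0 else \<bar>f x\<bar>)" for x
  define t where "t x = (if \<bar>f x\<bar> \<le> real k then f x else 0)" for x
  define \<mu> where "\<mu> = measure_pmf.expectation p f"
  define \<tau> where "\<tau> = measure_pmf.expectation p t"
  define g where "g x = t x - \<tau>" for x
  have r0: "0 \<le> r x" for x by (simp add: r_def)
  have t_int [simp]: "integrable (measure_pmf p) t"
    by (rule integrable_pmf_bounded[of _ "real k"]) (simp add: t_def)
  have r_int [simp]: "integrable (measure_pmf p) r"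
  proof (rule Bochner_Integration.integrable_bound[OF int])
    show "AE x in measure_pmf p. norm (r x) \<le> norm (f x)" by (simp add: r_def)
  qed simp
  have Er: "measure_pmf.expectation p r < \<eta>" using k by (simp add: r_def[abs_def])
  have ftr: "\<bar>f x - t x\<bar> = r x" for x by (simp add: r_def t_def)
  have "\<bar>\<mu> - \<tau>\<bar> = \<bar>measure_pmf.expectation p (\<lambda>x. f x - t x)\<bar>"
    by (simp add: \<mu>_def \<tau>_def int)
  also have "\<dots> \<le> measure_pmf.expectation p (\<lambda>x. \<bar>f x - t x\<bar>)" by (rule integral_abs_bound)
  also have "\<dots> < \<eta>" using Er by (simp add: ftr)
  finally have \<mu>\<tau>: "\<bar>\<mu> - \<tau>\<bar> < \<epsilon> / 3" using \<eta> by linarith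
  have \<tau>k: "\<bar>\<tau>\<bar> \<le> real k"
  proof -
    have "\<bar>\<tau>\<bar> \<le> measure_pmf.expectation p (\<lambda>x. \<bar>t x\<bar>)" unfolding \<tau>_def by (rule integral_abs_bound)
    also have "\<dots> \<le> measure_pmf.expectation p (\<lambda>x. real k)"
      by (intro expectation_pmf_mono integrable_abs t_int) (auto simp: t_def)
    finally show ?thesis by simp
  qed
  have g_le: "\<bar>g x\<bar> \<le> 2 * real k" for x
    using \<tau>k abs_triangle_ineq4[of "t x" \<tau>] by (auto simp: g_def t_def split: if_splits)
  have g_mean: "measure_pmf.expectation p g = 0" by (simp add: g_def[abs_def] \<tau>_def)
  have var: "measure_pmf.expectation p (\<lambda>x. (g x)\<^sup>2) \<le> (2 * real k)\<^sup>2"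
  proof -
    have "(g x)\<^sup>2 \<le> (2 * real k)\<^sup>2" for x using g_le[of x] abs_le_square_iff[of "g x" "2 * real k"] by simp
    then have "measure_pmf.expectation p (\<lambda>x. (g x)\<^sup>2) \<le> measure_pmf.expectation p (\<lambda>x. (2 * real k)\<^sup>2)"
      by (intro expectation_pmf_mono integrable_pmf_bounded[of _ "(2 * real k)\<^sup>2"]) auto
    then show ?thesis by simp
  qed
  have sum_g_le: "\<bar>sum_list (map g z)\<bar> \<le> real (length z) * (2 * real k)" for z
  proof (induction z)
    case (Cons a z)
    then show ?case using g_le[of a] by (simp add: algebra_simps)
  qed simp
  \<comment> \<open>The factor 36 is 4 * 9: the square of the bound \<open>2 * real k\<close> on
    \<open>g\<close>, divided by the square of the threshold \<epsilon>/3. The truncation level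
    \<open>k\<close> is fixed before \<open>n\<close>, so this term vanishes as \<open>n\<close>
    grows.\<close>
  have bound: "measure_pmf.prob (replicate_pmf n p)
      {z. \<bar>sum_list (map f z) / real n - \<mu>\<bar> > \<epsilon>} \<le> 36 * (real k)\<^sup>2 / \<epsilon>\<^sup>2 * (1 / real n) + \<delta> / 2"
    if n: "n > 0" for n
  proof -
    define G where "G = {z. \<bar>sum_list (map g z)\<bar> \<ge> real n * \<epsilon> / 3}"
    define R where "R = {z. sum_list (map r z) \<ge> real n * \<epsilon> / 3}"
    have nnr: "0 \<le> sum_list (map r z)" for z by (intro sum_list_nonneg) (use r0 in auto)
    have ne: "real n * \<epsilon> / 3 > 0" using n \<epsilon> by simp
    have "measure_pmf.prob (replicate_pmf n p) {z. \<bar>sum_list (map f z) / real n - \<mu>\<bar> > \<epsilon>}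
        \<le> measure_pmf.prob (replicate_pmf n p) (G \<union> R)"
    proof (rule prob_mono_set_pmf)
      fix z assume z: "z \<in> set_pmf (replicate_pmf n p)"
        and far: "z \<in> {z. \<bar>sum_list (map f z) / real n - \<mu>\<bar> > \<epsilon>}"
      have dev: "\<bar>sum_list (map f z) - sum_list (map g z) - real (length z) * \<tau>\<bar> \<le> sum_list (map r z)" for z
      proof (induction z)
        case (Cons a z)
        then show ?case using ftr[of a] by (simp add: g_def algebra_simps)
      qed simp
      have len: "length z = n" using z by (rule length_replicate_pmf)
      have "real n * \<epsilon> < real n * \<bar>sum_list (map f z) / real n - \<mu>\<bar>"
        using far n by simp
      also have "\<dots> = \<bar>real n * (sum_list (map f z) / real n - \<mu>)\<bar>" by (simp add: abs_mult)
      also have "\<dots> = \<bar>sum_list (map f z) - real n * \<mu>\<bar>" using n by (simp add: algebra_simps)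
      finally have A: "real n * \<epsilon> < \<bar>sum_list (map f z) - real n * \<mu>\<bar>" .
      have "real n * \<bar>\<mu> - \<tau>\<bar> \<le> real n * (\<epsilon> / 3)" by (intro mult_left_mono) (use \<mu>\<tau> in auto)
      then have "\<bar>real n * \<mu> - real n * \<tau>\<bar> \<le> real n * \<epsilon> / 3"
        by (simp add: abs_mult flip: right_diff_distrib)
      then have "\<bar>sum_list (map g z)\<bar> \<ge> real n * \<epsilon> / 3 \<or> sum_list (map r z) \<ge> real n * \<epsilon> / 3"
        using A dev[of z] unfolding len by linarith
      then show "z \<in> G \<union> R" unfolding G_def R_def by simp
    qed
    also have "\<dots> \<le> measure_pmf.prob (replicate_pmf n p) G + measure_pmf.prob (replicate_pmf n p) R"
      by (rule measure_Un_le) auto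
    also have "measure_pmf.prob (replicate_pmf n p) G \<le>
        measure_pmf.expectation (replicate_pmf n p) (\<lambda>z. (sum_list (map g z))\<^sup>2) / (real n * \<epsilon> / 3)\<^sup>2"
    proof -
      have "\<bar>(sum_list (map g z))\<^sup>2\<bar> \<le> (real (length z) * (2 * real k))\<^sup>2" for z
        using power_mono[OF sum_g_le[of z], of 2] by simp
      then have "integrable (measure_pmf (replicate_pmf n p)) (\<lambda>z. (sum_list (map g z))\<^sup>2)"
        by (intro measure_pmf.integrable_const_bound[where B = "(real n * (2 * real k))\<^sup>2"])
          (auto intro!: AE_pmfI dest!: length_replicate_pmf)
      from measure_pmf.second_moment_method[OF _ this ne]
      show ?thesis by (simp add: G_def)
    qed
    also have "\<dots> \<le> real n * (2 * real k)\<^sup>2 / (real n * \<epsilon> / 3)\<^sup>2"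
      using var by (intro divide_right_mono)
        (auto simp: expectation_replicate_sum_square[OF g_le g_mean] mult_left_mono)
    also have "\<dots> = 36 * (real k)\<^sup>2 / \<epsilon>\<^sup>2 * (1 / real n)"
      using n \<epsilon> by (simp add: power2_eq_square field_simps)
    also have "measure_pmf.prob (replicate_pmf n p) R \<le>
        measure_pmf.expectation (replicate_pmf n p) (\<lambda>z. sum_list (map r z)) / (real n * \<epsilon> / 3)"
      using integral_Markov_inequality_measure[of "replicate_pmf n p" "\<lambda>z. sum_list (map r z)" UNIV
          "real n * \<epsilon> / 3"] expectation_replicate_sum(1)[OF r0 r_int, of n] ne nnr
      by (simp add: R_def)
    also have "\<dots> = real n * measure_pmf.expectation p r / (real n * \<epsilon> / 3)"
      by (simp add: expectation_replicate_sum(2)[OF r0 r_int])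
    also have "\<dots> = 3 * measure_pmf.expectation p r / \<epsilon>" using n by simp
    also have "\<dots> \<le> 3 * \<eta> / \<epsilon>" using Er \<epsilon> by (intro divide_right_mono mult_left_mono) auto
    also have "\<dots> \<le> \<delta> / 2" using \<eta>(3) \<epsilon> by (simp add: field_simps)
    finally show ?thesis by simp
  qed
  have "(\<lambda>n. 36 * (real k)\<^sup>2 / \<epsilon>\<^sup>2 * (1 / real n)) \<longlonglongrightarrow> 36 * (real k)\<^sup>2 / \<epsilon>\<^sup>2 * 0"
    by (intro tendsto_mult_left lim_1_over_n)
  then have "\<forall>\<^sub>F n in sequentially. 36 * (real k)\<^sup>2 / \<epsilon>\<^sup>2 * (1 / real n) < \<delta> / 2"
    by (rule order_tendstoD(2)) (use \<delta> in simp)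
  then show "\<forall>\<^sub>F n in sequentially. dist (measure_pmf.prob (replicate_pmf n p)
      {z. \<bar>sum_list (map f z) / real n - measure_pmf.expectation p f\<bar> > \<epsilon>}) 0 < \<delta>"
    using eventually_gt_at_top[of 0]
  proof eventually_elim
    case (elim n)
    show ?case using bound[OF elim(2)] elim(1) by (simp add: \<mu>_def)
  qed
qed

section \<open>Asymptotic equipartition\<close>

text \<open>Entropy as the mean of the self-information, the form to which the weak law
  applies.\<close>

lemma pmf_entropy_expectation:
  fixes q :: "'a :: countable pmf"
  shows "pmf_entropy q = measure_pmf.expectation q (\<lambda>x. - log 2 (pmf q x))"
  unfolding pmf_entropy_eq measure_pmf_eq_density[of q]
  by (subst integral_density) auto

lemma pmf_finite_entropy_integrable:
  "pmf_finite_entropy q \<longleftrightarrow> integrable (measure_pmf q) (\<lambda>x. log 2 (pmf q x))"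
  unfolding pmf_finite_entropy_iff measure_pmf_eq_density[of q]
  by (subst integrable_density) auto

lemma pmf_le_pmf_map: "pmf p x \<le> pmf (map_pmf h p) (h x)"
  unfolding pmf_map unfolding measure_pmf_single[symmetric] by (intro measure_pmf.finite_measure_mono) auto

text \<open>On the support, an image point has mass between \<open>pmf p x\<close> and 1, so its
  logarithm is no larger in absolute value. Finite joint entropy thus passes to every
  marginal.\<close>

lemma integrable_log_pmf_map:
  assumes "integrable (measure_pmf p) (\<lambda>x. log 2 (pmf p x))"
  shows "integrable (measure_pmf p) (\<lambda>x. log 2 (pmf (map_pmf h p) (h x)))"
proof (rule Bochner_Integration.integrable_bound[OF assms])
  show "AE x in measure_pmf p. norm (log 2 (pmf (map_pmf h p) (h x))) \<le> norm (log 2 (pmf p x))"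
  proof (rule AE_pmfI)
    fix x assume "x \<in> set_pmf p"
    then have "0 < pmf p x" by (simp add: pmf_positive)
    then have "log 2 (pmf p x) \<le> log 2 (pmf (map_pmf h p) (h x))"
      and "log 2 (pmf (map_pmf h p) (h x)) \<le> 0"
      using pmf_le_pmf_map[of p x h] by (simp_all add: pmf_le_1)
    then show "norm (log 2 (pmf (map_pmf h p) (h x))) \<le> norm (log 2 (pmf p x))" by simp
  qed
qed simp

lemma pmf_entropy_map_expectation:
  fixes h :: "'a \<Rightarrow> 'b :: countable"
  shows "pmf_entropy (map_pmf h p) = measure_pmf.expectation p (\<lambda>x. - log 2 (pmf (map_pmf h p) (h x)))"
  by (simp only: pmf_entropy_expectation integral_map_pmf)

section \<open>Memoryless kernels and independent samples as lists\<close>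

lemma memoryless_Nil: "memoryless W [] = return_pmf []"
  by (simp add: memoryless_def)

text \<open>This recursion replaces the product over index functions by induction on the input
  sequence.\<close>

lemma memoryless_Cons:
  "memoryless W (x # xs) = do {y \<leftarrow> W x; ys \<leftarrow> memoryless W xs; return_pmf (y # ys)}"
proof -
  have "memoryless W (x # xs) = map_pmf (\<lambda>(y, ys). y # ys) (pair_pmf (W x) (memoryless W xs))"
  proof (rule pmf_eqI)
    fix zs
    show "pmf (memoryless W (x # xs)) zs =
        pmf (map_pmf (\<lambda>(y, ys). y # ys) (pair_pmf (W x) (memoryless W xs))) zs"
    proof (cases zs)
      case Nil
      then have "zs \<notin> set_pmf (map_pmf (\<lambda>(y, ys). y # ys) (pair_pmf (W x) (memoryless W xs)))" by auto
      with Nil show ?thesis by (simp add: pmf_memoryless pmf_eq_0_set_pmf)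
    next
      case (Cons y ys)
      have "inj (\<lambda>(y, ys). y # ys)" by (auto simp: inj_def)
      from pmf_map_inj'[OF this, of "pair_pmf (W x) (memoryless W xs)" "(y, ys)"]
      show ?thesis by (simp add: Cons pmf_memoryless pmf_pair prod.lessThan_Suc_shift del: prod.lessThan_Suc)
    qed
  qed
  then show ?thesis by (simp add: map_pmf_def pair_pmf_def bind_assoc_pmf bind_return_pmf)
qed

lemma replicate_pmf_eq_memoryless: "replicate_pmf n p = memoryless (\<lambda>_. p) (replicate n ())"
  by (induction n) (simp_all add: memoryless_Nil memoryless_Cons)

lemma pmf_replicate_pmf:
  "pmf (replicate_pmf n p) z = (if length z = n then \<Prod>i<n. pmf p (z ! i) else 0)"
  by (auto simp: replicate_pmf_eq_memoryless pmf_memoryless)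

lemma map_replicate_pmf: "map_pmf (map h) (replicate_pmf n p) = replicate_pmf n (map_pmf h p)"
proof (induction n)
  case (Suc n)
  then show ?case by (simp add: map_bind_pmf bind_map_pmf flip: Suc.IH)
qed simp

lemma bind_joint_pmf: "bind_pmf (joint_pmf p K) f = do {u \<leftarrow> p; v \<leftarrow> K u; f (u, v)}"
  by (simp add: joint_pmf_def bind_assoc_pmf bind_return_pmf)

text \<open>Independent pairs may be drawn by first drawing all the first components: in the
  induction step, the current second component and the remaining first components do not depend on
  each other, so their draws commute.\<close>

lemma replicate_pmf_joint_pmf:
  "replicate_pmf n (joint_pmf p K) =
    do {u \<leftarrow> replicate_pmf n p; v \<leftarrow> memoryless K u; return_pmf (zip u v)}"
proof (induction n)
  case (Suc n)
  have "replicate_pmf (Suc n) (joint_pmf p K) =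
      do {u \<leftarrow> p; v \<leftarrow> K u; us \<leftarrow> replicate_pmf n p; vs \<leftarrow> memoryless K us; return_pmf ((u, v) # zip us vs)}"
    by (simp add: Suc.IH bind_joint_pmf bind_assoc_pmf bind_return_pmf)
  also have "\<dots> = do {u \<leftarrow> p; us \<leftarrow> replicate_pmf n p; v \<leftarrow> K u; vs \<leftarrow> memoryless K us;
      return_pmf ((u, v) # zip us vs)}"
    by (rule bind_pmf_cong[OF refl]) (rule bind_commute_pmf)
  finally show ?case by (simp add: memoryless_Cons bind_assoc_pmf bind_return_pmf)
qed (simp add: memoryless_Nil bind_return_pmf)

text \<open>Connects the kernel in the \<B>-typical set with the coding experiment: the signs are
  drawn first, uniformly, and then the product sequence is sent through the channel. The draws
  commute as for \<open>replicate_pmf_joint_pmf\<close>.\<close>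

lemma memoryless_sy_given:
  "memoryless (sy_given W) u = do {s \<leftarrow> replicate_pmf (length u) (pmf_of_set signs);
     y \<leftarrow> memoryless W (map2 (*) u s); return_pmf (zip s y)}"
proof (induction u)
  case (Cons a u)
  have "memoryless (sy_given W) (a # u) = do {s \<leftarrow> pmf_of_set signs; y \<leftarrow> W (a * s);
      ss \<leftarrow> replicate_pmf (length u) (pmf_of_set signs); ys \<leftarrow> memoryless W (map2 (*) u ss);
      return_pmf ((s, y) # zip ss ys)}"
    by (simp add: memoryless_Cons Cons.IH sy_given_def bind_assoc_pmf bind_return_pmf mult.commute)
  also have "\<dots> = do {s \<leftarrow> pmf_of_set signs; ss \<leftarrow> replicate_pmf (length u) (pmf_of_set signs);
      y \<leftarrow> W (a * s); ys \<leftarrow> memoryless W (map2 (*) u ss); return_pmf ((s, y) # zip ss ys)}"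
    by (rule bind_pmf_cong[OF refl]) (rule bind_commute_pmf)
  finally show ?case by (simp add: memoryless_Cons bind_assoc_pmf bind_return_pmf)
qed (simp add: memoryless_Nil bind_return_pmf)

lemma log_prod_nth:
  assumes "\<And>x. x \<in> set z \<Longrightarrow> 0 < q x"
  shows "0 < (\<Prod>i<length z. q (z ! i))"
    and "log 2 (\<Prod>i<length z. q (z ! i)) = sum_list (map (\<lambda>x. log 2 (q x)) z)"
proof -
  have "0 < (\<Prod>i<length z. q (z ! i)) \<and>
      log 2 (\<Prod>i<length z. q (z ! i)) = sum_list (map (\<lambda>x. log 2 (q x)) z)"
    using assms
  proof (induction z)
    case (Cons a z)
    have eq: "(\<Prod>i<length (a # z). q ((a # z) ! i)) = q a * (\<Prod>i<length z. q (z ! i))"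
      by (simp add: prod.lessThan_Suc_shift del: prod.lessThan_Suc)
    have pos: "0 < q a" "0 < (\<Prod>i<length z. q (z ! i))"
      and log: "log 2 (\<Prod>i<length z. q (z ! i)) = sum_list (map (\<lambda>x. log 2 (q x)) z)"
      using Cons by auto
    show ?case
      unfolding eq log_mult_pos[OF pos] log using pos by simp
  qed simp
  then show "0 < (\<Prod>i<length z. q (z ! i))"
    and "log 2 (\<Prod>i<length z. q (z ! i)) = sum_list (map (\<lambda>x. log 2 (q x)) z)" by auto
qed

text \<open>The weak law for the self-information of \<open>h x\<close>, whose sum along a sample is
  minus the log-probability of the image sequence. Samples stay in the support, so this probability
  is positive. The map \<open>h\<close> will pick out a subset of the coordinates of a
  triple.\<close>

theorem asymptotic_equipartition:
  fixes h :: "'a \<Rightarrow> 'b :: countable"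
  assumes "integrable (measure_pmf p) (\<lambda>x. log 2 (pmf p x))" and "\<epsilon> > 0"
  shows "(\<lambda>n. measure_pmf.prob (replicate_pmf n p)
    {z. \<not> entropy_typical n \<epsilon> (map_pmf h p) (map h z)}) \<longlonglongrightarrow> 0"
proof -
  define f where "f x = - log 2 (pmf (map_pmf h p) (h x))" for x
  have int: "integrable (measure_pmf p) f"
    using integrable_log_pmf_map[OF assms(1)] by (simp add: f_def[abs_def])
  have Ef: "measure_pmf.expectation p f = pmf_entropy (map_pmf h p)"
    by (simp only: pmf_entropy_map_expectation f_def[abs_def])
  have "measure_pmf.prob (replicate_pmf n p) {z. \<not> entropy_typical n \<epsilon> (map_pmf h p) (map h z)} \<le>
      measure_pmf.prob (replicate_pmf n p)
        {z. \<bar>sum_list (map f z) / real n - measure_pmf.expectation p f\<bar> > \<epsilon>}" for n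
  proof (rule prob_mono_set_pmf)
    fix z assume "z \<in> set_pmf (replicate_pmf n p)"
      and nt: "z \<in> {z. \<not> entropy_typical n \<epsilon> (map_pmf h p) (map h z)}"
    then have z: "length z = n" "set z \<subseteq> set_pmf p" by (auto simp: set_replicate_pmf)
    have pos: "0 < pmf (map_pmf h p) x" if "x \<in> set (map h z)" for x
      using that z(2) by (auto intro!: pmf_positive)
    have "sum_list (map f z) = - sum_list (map (\<lambda>x. log 2 (pmf (map_pmf h p) x)) (map h z))"
      by (simp add: f_def[abs_def] o_def uminus_sum_list_map)
    then show "z \<in> {z. \<bar>sum_list (map f z) / real n - measure_pmf.expectation p f\<bar> > \<epsilon>}"
      using log_prod_nth[of "map h z" "pmf (map_pmf h p)", OF pos] nt z(1)
      by (simp add: entropy_typical_def Ef)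
  qed
  then show ?thesis
    by (intro tendsto_sandwich[OF _ _ tendsto_const weak_law_of_large_numbers[OF int assms(2)]] always_eventually)
      auto
qed

section \<open>Joint typicality of random triples\<close>

lemma prob_Un_tendsto_0:
  assumes "(\<lambda>n. measure_pmf.prob (p n) {z. \<not> A n z}) \<longlonglongrightarrow> 0"
    and "(\<lambda>n. measure_pmf.prob (p n) {z. \<not> B n z}) \<longlonglongrightarrow> 0"
  shows "(\<lambda>n. measure_pmf.prob (p n) {z. \<not> (A n z \<and> B n z)}) \<longlonglongrightarrow> 0"
proof (rule tendsto_sandwich[OF _ _ tendsto_const[of 0]])
  show "(\<lambda>n. measure_pmf.prob (p n) {z. \<not> A n z} + measure_pmf.prob (p n) {z. \<not> B n z}) \<longlonglongrightarrow> 0"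
    using tendsto_add[OF assms] by simp
  have "{z. \<not> (A n z \<and> B n z)} = {z. \<not> A n z} \<union> {z. \<not> B n z}" for n by auto
  then show "\<forall>\<^sub>F n in sequentially. measure_pmf.prob (p n) {z. \<not> (A n z \<and> B n z)}
      \<le> measure_pmf.prob (p n) {z. \<not> A n z} + measure_pmf.prob (p n) {z. \<not> B n z}"
    by (intro always_eventually allI) (simp add: measure_Un_le)
qed auto

text \<open>Typicality for a single list of triples, the shape in which samples of
  \<open>replicate_pmf n P\<close> come.\<close>

definition typical_joint :: "nat \<Rightarrow> real \<Rightarrow> ('a \<times> 'b \<times> 'c) pmf \<Rightarrow> ('a \<times> 'b \<times> 'c) list \<Rightarrow> bool" where
  "typical_joint n \<epsilon> P z \<longleftrightarrow>
     (map fst z, map (fst \<circ> snd) z, map (snd \<circ> snd) z) \<in> typical3 n \<epsilon> P"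

lemma zip_map_same: "zip (map f z) (map g z) = map (\<lambda>x. (f x, g x)) z"
  by (induction z) auto

text \<open>Each of the seven conditions is brought to the form \<open>map_pmf h P\<close> against
  \<open>map h z\<close>, with the identity as \<open>h\<close> for the full triple, so that
  \<open>asymptotic_equipartition\<close> applies to each of them.\<close>

lemma typical_joint_iff:
  assumes "length z = n"
  shows "typical_joint n \<epsilon> P z \<longleftrightarrow>
    entropy_typical n \<epsilon> (map_pmf (\<lambda>(x, y, z). x) P) (map (\<lambda>(x, y, z). x) z) \<and>
    entropy_typical n \<epsilon> (map_pmf (\<lambda>(x, y, z). y) P) (map (\<lambda>(x, y, z). y) z) \<and>
    entropy_typical n \<epsilon> (map_pmf (\<lambda>(x, y, z). z) P) (map (\<lambda>(x, y, z). z) z) \<and>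
    entropy_typical n \<epsilon> (map_pmf (\<lambda>(x, y, z). (x, y)) P) (map (\<lambda>(x, y, z). (x, y)) z) \<and>
    entropy_typical n \<epsilon> (map_pmf (\<lambda>(x, y, z). (x, z)) P) (map (\<lambda>(x, y, z). (x, z)) z) \<and>
    entropy_typical n \<epsilon> (map_pmf (\<lambda>(x, y, z). (y, z)) P) (map (\<lambda>(x, y, z). (y, z)) z) \<and>
    entropy_typical n \<epsilon> (map_pmf (\<lambda>x. x) P) (map (\<lambda>x. x) z)"
  using assms
  by (simp add: typical_joint_def typical3_def zip_map_same o_def case_prod_unfold)

theorem typical_joint_tendsto:
  fixes P :: "('a :: countable \<times> 'b :: countable \<times> 'c :: countable) pmf"
  assumes "pmf_finite_entropy P" and "\<epsilon> > 0"
  shows "(\<lambda>n. measure_pmf.prob (replicate_pmf n P) {z. \<not> typical_joint n \<epsilon> P z}) \<longlonglongrightarrow> 0"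
proof -
  have int: "integrable (measure_pmf P) (\<lambda>x. log 2 (pmf P x))"
    using assms(1) by (simp add: pmf_finite_entropy_integrable)
  show ?thesis
  proof (rule tendsto_sandwich[OF _ _ tendsto_const])
    show "(\<lambda>n. measure_pmf.prob (replicate_pmf n P) {z. \<not>
      (entropy_typical n \<epsilon> (map_pmf (\<lambda>(x, y, z). x) P) (map (\<lambda>(x, y, z). x) z) \<and>
      entropy_typical n \<epsilon> (map_pmf (\<lambda>(x, y, z). y) P) (map (\<lambda>(x, y, z). y) z) \<and>
      entropy_typical n \<epsilon> (map_pmf (\<lambda>(x, y, z). z) P) (map (\<lambda>(x, y, z). z) z) \<and>
      entropy_typical n \<epsilon> (map_pmf (\<lambda>(x, y, z). (x, y)) P) (map (\<lambda>(x, y, z). (x, y)) z) \<and>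
      entropy_typical n \<epsilon> (map_pmf (\<lambda>(x, y, z). (x, z)) P) (map (\<lambda>(x, y, z). (x, z)) z) \<and>
      entropy_typical n \<epsilon> (map_pmf (\<lambda>(x, y, z). (y, z)) P) (map (\<lambda>(x, y, z). (y, z)) z) \<and>
      entropy_typical n \<epsilon> (map_pmf (\<lambda>x. x) P) (map (\<lambda>x. x) z))}) \<longlonglongrightarrow> 0"
      by (intro prob_Un_tendsto_0 asymptotic_equipartition int assms(2))
    show "\<forall>\<^sub>F n in sequentially. measure_pmf.prob (replicate_pmf n P) {z. \<not> typical_joint n \<epsilon> P z} \<le>
      measure_pmf.prob (replicate_pmf n P) {z. \<not>
      (entropy_typical n \<epsilon> (map_pmf (\<lambda>(x, y, z). x) P) (map (\<lambda>(x, y, z). x) z) \<and>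
      entropy_typical n \<epsilon> (map_pmf (\<lambda>(x, y, z). y) P) (map (\<lambda>(x, y, z). y) z) \<and>
      entropy_typical n \<epsilon> (map_pmf (\<lambda>(x, y, z). z) P) (map (\<lambda>(x, y, z). z) z) \<and>
      entropy_typical n \<epsilon> (map_pmf (\<lambda>(x, y, z). (x, y)) P) (map (\<lambda>(x, y, z). (x, y)) z) \<and>
      entropy_typical n \<epsilon> (map_pmf (\<lambda>(x, y, z). (x, z)) P) (map (\<lambda>(x, y, z). (x, z)) z) \<and>
      entropy_typical n \<epsilon> (map_pmf (\<lambda>(x, y, z). (y, z)) P) (map (\<lambda>(x, y, z). (y, z)) z) \<and>
      entropy_typical n \<epsilon> (map_pmf (\<lambda>x. x) P) (map (\<lambda>x. x) z))}"
      by (intro always_eventually allI prob_mono_set_pmf)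
        (use typical_joint_iff length_replicate_pmf in blast)
  qed simp
qed

section \<open>Mutual information of the channel input and output\<close>

lemma distributed_map_pmf:
  "distributed (measure_pmf P) (count_space UNIV) X (pmf (map_pmf X P))"
  by (simp add: distributed_def map_pmf_rep_eq[symmetric] measure_pmf_eq_density[symmetric])

lemma entropy_map_pmf:
  fixes Z :: "'w \<Rightarrow> 'c :: countable"
  shows "prob_space.entropy (measure_pmf P) 2 (count_space UNIV) Z = pmf_entropy (map_pmf Z P)"
proof -
  interpret information_space "measure_pmf P" 2 by (rule information_space_pmf)
  interpret C: sigma_finite_measure "count_space (UNIV :: 'c set)"
    by (rule sigma_finite_measure_count_space)
  show ?thesis
    unfolding pmf_entropy_eq by (rule entropy_distr[OF distributed_map_pmf]) simp
qed

text \<open>For countable alphabets the product of the counting measures is the counting measure on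
  pairs, so the general identity for densities applies. Its integrability conditions on the
  marginals follow from that of the pair by \<open>integrable_log_pmf_map\<close>.\<close>

lemma pmf_mutual_info_entropy:
  fixes X :: "'w \<Rightarrow> 'a :: countable" and Y :: "'w \<Rightarrow> 'b :: countable"
  assumes "pmf_finite_entropy (map_pmf (\<lambda>w. (X w, Y w)) P)"
  shows "pmf_mutual_info P X Y = pmf_entropy (map_pmf X P) + pmf_entropy (map_pmf Y P)
    - pmf_entropy (map_pmf (\<lambda>w. (X w, Y w)) P)"
proof -
  define Q where "Q = map_pmf (\<lambda>w. (X w, Y w)) P"
  have Qlog: "integrable (measure_pmf Q) (\<lambda>x. log 2 (pmf Q x))"
    using assms by (simp add: Q_def pmf_finite_entropy_integrable)
  have to_count: "integrable (count_space UNIV) (\<lambda>x. pmf Q x * f x)"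
    if "integrable (measure_pmf Q) f" for f
    using that unfolding measure_pmf_eq_density[of Q] by (subst (asm) integrable_density) auto
  have fstQ: "map_pmf fst Q = map_pmf X P" and sndQ: "map_pmf snd Q = map_pmf Y P"
    by (simp_all add: Q_def map_pmf_comp)
  have ST: "count_space (UNIV :: 'a set) \<Otimes>\<^sub>M count_space (UNIV :: 'b set) = count_space UNIV"
    by (simp add: pair_measure_countable)
  have "prob_space.mutual_information (measure_pmf P) 2 (count_space UNIV) (count_space UNIV) X Y =
      prob_space.entropy (measure_pmf P) 2 (count_space UNIV) X + prob_space.entropy (measure_pmf P) 2 (count_space UNIV) Y
      - prob_space.entropy (measure_pmf P) 2 (count_space UNIV \<Otimes>\<^sub>M count_space UNIV) (\<lambda>x. (X x, Y x))"
  proof (rule information_space.mutual_information_eq_entropy_conditional_entropy_distr[OF information_space_pmf])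
    show "distributed (measure_pmf P) (count_space UNIV) X (pmf (map_pmf X P))"
      and "distributed (measure_pmf P) (count_space UNIV) Y (pmf (map_pmf Y P))"
      by (rule distributed_map_pmf)+
    show "distributed (measure_pmf P) (count_space UNIV \<Otimes>\<^sub>M count_space UNIV) (\<lambda>x. (X x, Y x)) (pmf Q)"
      unfolding ST Q_def by (rule distributed_map_pmf)
    show "integrable (count_space UNIV \<Otimes>\<^sub>M count_space UNIV) (\<lambda>x. pmf Q x * log 2 (pmf (map_pmf X P) (fst x)))"
      unfolding ST using to_count[OF integrable_log_pmf_map[OF Qlog, of fst]] by (simp add: fstQ)
    show "integrable (count_space UNIV \<Otimes>\<^sub>M count_space UNIV) (\<lambda>x. pmf Q x * log 2 (pmf (map_pmf Y P) (snd x)))"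
      unfolding ST using to_count[OF integrable_log_pmf_map[OF Qlog, of snd]] by (simp add: sndQ)
    show "integrable (count_space UNIV \<Otimes>\<^sub>M count_space UNIV) (\<lambda>x. pmf Q x * log 2 (pmf Q x))"
      unfolding ST using to_count[OF Qlog] .
  qed (simp_all add: sigma_finite_measure_count_space)
  then show ?thesis unfolding pmf_mutual_info_def ST entropy_map_pmf .
qed

lemma pmf_entropy_map_inj:
  fixes q :: "'a :: countable pmf" and f :: "'a \<Rightarrow> 'b :: countable"
  assumes "inj f"
  shows "pmf_entropy (map_pmf f q) = pmf_entropy q"
  unfolding pmf_entropy_map_expectation pmf_map_inj'[OF assms]
  by (rule pmf_entropy_expectation[symmetric])

lemma pmf_finite_entropy_map:
  assumes "pmf_finite_entropy q"
  shows "pmf_finite_entropy (map_pmf f q)"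
  using integrable_log_pmf_map assms by (auto simp: pmf_finite_entropy_integrable)

lemma pmf_signs: "s \<in> signs \<Longrightarrow> pmf (pmf_of_set signs) s = 1 / 2"
  by (auto simp: signs_def)

lemma set_pmf_signs [simp]: "set_pmf (pmf_of_set signs) = signs"
  by (simp add: signs_def)

lemma map_pmf_joint_pmf_fst: "map_pmf fst (joint_pmf p K) = p"
  by (simp add: joint_pmf_def map_bind_pmf bind_return_pmf')

lemma map_pmf_asy_sa: "map_pmf (\<lambda>(a, s, y). (s, a)) (asy_pmf W p) = pair_pmf (pmf_of_set signs) p"
proof -
  have "map_pmf (\<lambda>(a, s, y). (s, a)) (asy_pmf W p) =
      do {a \<leftarrow> p; s \<leftarrow> pmf_of_set signs; return_pmf (s, a)}"
    by (simp add: asy_pmf_def joint_pmf_def sy_given_def map_bind_pmf bind_assoc_pmf bind_return_pmf)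
  also have "\<dots> = pair_pmf (pmf_of_set signs) p"
    unfolding pair_pmf_def by (rule bind_commute_pmf)
  finally show ?thesis .
qed

text \<open>The sign is a fair bit independent of the amplitude and contributes the summand 1 to the
  entropy of the pair; regrouping \<open>(a, s, y)\<close> as \<open>((s, a), y)\<close> is
  injective and keeps the joint entropy.\<close>

lemma info_SA_Y_eq:
  fixes W :: "int \<Rightarrow> 'y :: countable pmf"
  assumes fin: "pmf_finite_entropy (asy_pmf W p)"
  shows "info_SA_Y W p = pmf_entropy p + 1 + pmf_entropy (map_pmf (\<lambda>(a, s, y). y) (asy_pmf W p))
    - pmf_entropy (asy_pmf W p)"
proof -
  have "pmf_finite_entropy (map_pmf fst (asy_pmf W p))" by (rule pmf_finite_entropy_map) (rule fin)
  then have p_int: "integrable (measure_pmf p) (\<lambda>a. log 2 (pmf p a))"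
    by (simp add: asy_pmf_def map_pmf_joint_pmf_fst pmf_finite_entropy_integrable)
  have "pmf_entropy (pair_pmf (pmf_of_set signs) p) =
      measure_pmf.expectation (pair_pmf (pmf_of_set signs) p) (\<lambda>x. 1 - log 2 (pmf p (snd x)))"
    unfolding pmf_entropy_expectation
  proof (intro integral_cong_AE AE_pmfI)
    fix x assume "x \<in> set_pmf (pair_pmf (pmf_of_set signs) p)"
    then obtain s a where x: "x = (s, a)" "s \<in> signs" "a \<in> set_pmf p" by auto
    then have "pmf p a > 0" by (simp add: pmf_positive)
    then show "- log 2 (pmf (pair_pmf (pmf_of_set signs) p) x) = 1 - log 2 (pmf p (snd x))"
      using x by (simp add: pmf_pair pmf_signs log_divide)
  qed simp_all
  also have "\<dots> = 1 + pmf_entropy p"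
    using p_int
    by (simp add: pmf_entropy_expectation expectation_pair_pmf_snd[of _ _ "\<lambda>a. 1 - log 2 (pmf p a)"])
  finally have sa: "pmf_entropy (map_pmf (\<lambda>(a, s, y). (s, a)) (asy_pmf W p)) = 1 + pmf_entropy p"
    by (simp add: map_pmf_asy_sa)
  have inj: "inj (\<lambda>(a :: int, s :: int, y :: 'y). ((s, a), y))" by (auto simp: inj_def)
  have eq: "(\<lambda>w. ((case w of (a, s, y) \<Rightarrow> (s, a)), (case w of (a, s, y) \<Rightarrow> y))) =
      (\<lambda>(a :: int, s :: int, y :: 'y). ((s, a), y))" by auto
  have "info_SA_Y W p = pmf_entropy (map_pmf (\<lambda>(a, s, y). (s, a)) (asy_pmf W p))
      + pmf_entropy (map_pmf (\<lambda>(a, s, y). y) (asy_pmf W p))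
      - pmf_entropy (map_pmf (\<lambda>(a, s, y). ((s, a), y)) (asy_pmf W p))"
    unfolding info_SA_Y_def
    by (subst pmf_mutual_info_entropy) (simp_all only: eq pmf_finite_entropy_map fin)
  then show ?thesis by (simp only: sa pmf_entropy_map_inj[OF inj])
qed

section \<open>Sizes of typical sets\<close>

lemma entropy_typical_pmf_bounds:
  assumes "entropy_typical n \<epsilon> p z" and "n > 0"
  shows "2 powr (- real n * (pmf_entropy p + \<epsilon>)) \<le> pmf (replicate_pmf n p) z"
    and "pmf (replicate_pmf n p) z \<le> 2 powr (- real n * (pmf_entropy p - \<epsilon>))"
proof -
  define q where "q = pmf (replicate_pmf n p) z"
  have q: "q > 0" "\<bar>- (1 / real n) * log 2 q - pmf_entropy p\<bar> \<le> \<epsilon>"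
    using assms by (auto simp: entropy_typical_def q_def pmf_replicate_pmf)
  have "real n * \<bar>- (1 / real n) * log 2 q - pmf_entropy p\<bar> \<le> real n * \<epsilon>"
    using q by (intro mult_left_mono) auto
  also have "real n * \<bar>- (1 / real n) * log 2 q - pmf_entropy p\<bar> =
      \<bar>real n * (- (1 / real n) * log 2 q - pmf_entropy p)\<bar>" by (simp add: abs_mult)
  also have "real n * (- (1 / real n) * log 2 q - pmf_entropy p) = - log 2 q - real n * pmf_entropy p"
    using assms(2) by (simp add: algebra_simps)
  finally have "- real n * (pmf_entropy p + \<epsilon>) \<le> log 2 q" "log 2 q \<le> - real n * (pmf_entropy p - \<epsilon>)"
    by (auto simp: algebra_simps abs_le_iff)
  then show "2 powr (- real n * (pmf_entropy p + \<epsilon>)) \<le> pmf (replicate_pmf n p) z"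
    and "pmf (replicate_pmf n p) z \<le> 2 powr (- real n * (pmf_entropy p - \<epsilon>))"
    using q(1) unfolding q_def[symmetric] by (simp_all add: le_log_iff log_le_iff)
qed

text \<open>Distinct pairs give distinct triple sequences, each of mass at least
  \<open>2 powr (- n * (H(P) + \<epsilon>))\<close>, and all of them project to \<open>c\<close>, so
  their total mass is at most the probability of \<open>c\<close>. Dividing gives the bound; one
  \<epsilon> comes from each side. A member of \<open>F\<close> is what shows that \<open>c\<close>
  itself is typical, hence the separate empty case.\<close>

lemma card_typical_slice:
  fixes P :: "('a \<times> 'b \<times> 'c) pmf"
  assumes "finite F" and F: "\<And>a b. (a, b) \<in> F \<Longrightarrow> (a, b, c) \<in> typical3 n \<epsilon> P" and n: "n > 0"
  shows "real (card F) \<le> 2 powr (real n *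
    (pmf_entropy P - pmf_entropy (map_pmf (\<lambda>(x, y, z). z) P) + 2 * \<epsilon>))"
proof (cases "F = {}")
  case False
  then obtain a0 b0 where "(a0, b0) \<in> F" by auto
  from F[OF this] have c: "entropy_typical n \<epsilon> (map_pmf (\<lambda>(x, y, z). z) P) c" "length c = n"
    by (auto simp: typical3_def)
  define Z where "Z = (\<lambda>(a, b). zip a (zip b c)) ` F"
  have len: "length a = n \<and> length b = n" if "(a, b) \<in> F" for a b
    using F[OF that] by (auto simp: typical3_def)
  have inj: "inj_on (\<lambda>(a, b). zip a (zip b c)) F"
  proof (rule inj_on_inverseI[where g = "\<lambda>z. (map fst z, map fst (map snd z))"])
    fix x assume "x \<in> F"
    then show "(\<lambda>z. (map fst z, map fst (map snd z))) ((\<lambda>(a, b). zip a (zip b c)) x) = x"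
      using len[of "fst x" "snd x"] c(2)
      by (simp add: case_prod_unfold map_fst_zip map_snd_zip del: map_map)
  qed
  have "real (card F) * 2 powr (- real n * (pmf_entropy P + \<epsilon>)) =
      (\<Sum>z\<in>Z. 2 powr (- real n * (pmf_entropy P + \<epsilon>)))"
    using inj by (simp add: Z_def card_image)
  also have "\<dots> \<le> (\<Sum>z\<in>Z. pmf (replicate_pmf n P) z)"
    using F n by (intro sum_mono entropy_typical_pmf_bounds(1)) (auto simp: Z_def typical3_def)
  also have "\<dots> = measure_pmf.prob (replicate_pmf n P) Z"
    using assms(1) by (intro measure_measure_pmf_finite[symmetric]) (simp add: Z_def)
  also have "\<dots> \<le> measure_pmf.prob (replicate_pmf n P) (map (\<lambda>(x, y, z). z) -` {c})"
  proof (intro measure_pmf.finite_measure_mono subsetI)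
    fix z assume "z \<in> Z"
    then obtain a b where z: "z = zip a (zip b c)" "(a, b) \<in> F" by (auto simp: Z_def)
    have "map (\<lambda>(x, y, z). z) z = map snd (map snd z)" by (simp add: case_prod_unfold)
    also have "\<dots> = c" unfolding z(1) using len[OF z(2)] c(2) by (simp add: map_snd_zip del: map_map)
    finally show "z \<in> map (\<lambda>(x, y, z). z) -` {c}" by simp
  qed simp
  also have "\<dots> = pmf (replicate_pmf n (map_pmf (\<lambda>(x, y, z). z) P)) c"
    by (simp add: pmf_map flip: map_replicate_pmf)
  also have "\<dots> \<le> 2 powr (- real n * (pmf_entropy (map_pmf (\<lambda>(x, y, z). z) P) - \<epsilon>))"
    by (rule entropy_typical_pmf_bounds(2)[OF c(1) n])
  finally have "real (card F) \<le> 2 powr (- real n * (pmf_entropy (map_pmf (\<lambda>(x, y, z). z) P) - \<epsilon>)) /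
      2 powr (- real n * (pmf_entropy P + \<epsilon>))" by (simp add: field_simps)
  also have "\<dots> = 2 powr (real n *
      (pmf_entropy P - pmf_entropy (map_pmf (\<lambda>(x, y, z). z) P) + 2 * \<epsilon>))"
    by (simp add: algebra_simps flip: powr_diff)
  finally show ?thesis .
qed simp

section \<open>Probability and size of the \<B>-typical set\<close>

lemma length_memoryless: "v \<in> set_pmf (memoryless K u) \<Longrightarrow> length v = length u"
  by (auto simp: memoryless_def)

lemma prob_map_pmf: "measure_pmf.prob (map_pmf f p) A = measure_pmf.prob p {x. f x \<in> A}"
  by (simp add: vimage_def)

lemma prob_return_pmf_bind:
  "measure_pmf.prob (do {x \<leftarrow> p; return_pmf (f x)}) A = measure_pmf.prob p {x. f x \<in> A}"
  by (simp only: map_pmf_def[symmetric] prob_map_pmf)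

text \<open>Averaging the conditional failure probability over the first component gives the joint
  one, by \<open>replicate_pmf_joint_pmf\<close>.\<close>

lemma expectation_not_typical:
  "measure_pmf.expectation (replicate_pmf n p) (\<lambda>u. measure_pmf.prob (memoryless K u)
      {vw. (u, map fst vw, map snd vw) \<notin> typical3 n \<epsilon> (joint_pmf p K)}) =
    measure_pmf.prob (replicate_pmf n (joint_pmf p K)) {z. \<not> typical_joint n \<epsilon> (joint_pmf p K) z}"
proof -
  have "measure_pmf.prob (memoryless K u) {v. \<not> typical_joint n \<epsilon> (joint_pmf p K) (zip u v)} =
      measure_pmf.prob (memoryless K u) {vw. (u, map fst vw, map snd vw) \<notin> typical3 n \<epsilon> (joint_pmf p K)}" for u
  proof (intro measure_pmf.finite_measure_eq_AE AE_pmfI)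
    fix v assume "v \<in> set_pmf (memoryless K u)"
    then have "length v = length u" by (rule length_memoryless)
    then show "v \<in> {v. \<not> typical_joint n \<epsilon> (joint_pmf p K) (zip u v)} \<longleftrightarrow>
        v \<in> {vw. (u, map fst vw, map snd vw) \<notin> typical3 n \<epsilon> (joint_pmf p K)}"
      by (simp add: typical_joint_def map_snd_zip flip: map_map)
  qed simp_all
  then show ?thesis
    by (simp add: replicate_pmf_joint_pmf prob_bind_pmf[of "replicate_pmf n p"] prob_return_pmf_bind)
qed

text \<open>Markov's inequality for the conditional failure probability \<open>g\<close>: its mean
  is eventually below \<open>\<epsilon> * \<epsilon>\<close>, so it reaches \<epsilon> with
  probability at most \<epsilon>.\<close>

theorem prob_B_typical:
  fixes p :: "'a :: countable pmf" and K :: "'a \<Rightarrow> ('b :: countable \<times> 'c :: countable) pmf"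
  assumes fin: "pmf_finite_entropy (joint_pmf p K)" and \<epsilon>: "0 < \<epsilon>" "\<epsilon> < 1"
  shows "\<forall>\<^sub>F n in sequentially. measure_pmf.prob (replicate_pmf n p) (B_typical n \<epsilon> p K) \<ge> 1 - \<epsilon>"
proof -
  have "\<forall>\<^sub>F n in sequentially. measure_pmf.prob (replicate_pmf n (joint_pmf p K))
      {z. \<not> typical_joint n \<epsilon> (joint_pmf p K) z} < \<epsilon> * \<epsilon>"
    using \<epsilon> by (intro order_tendstoD(2)[OF typical_joint_tendsto[OF fin]]) auto
  then show ?thesis
  proof eventually_elim
    case (elim n)
    define T where "T = typical3 n \<epsilon> (joint_pmf p K)"
    define g where "g u = measure_pmf.prob (memoryless K u) {vw. (u, map fst vw, map snd vw) \<notin> T}" for u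
    have g_compl: "measure_pmf.prob (memoryless K u) {vw. (u, map fst vw, map snd vw) \<in> T} = 1 - g u" for u
      using measure_pmf.prob_compl[of "{vw. (u, map fst vw, map snd vw) \<notin> T}" "memoryless K u"]
      by (simp add: g_def Compl_eq flip: Compl_eq_Diff_UNIV)
    have sub: "- {u. g u \<ge> \<epsilon>} \<subseteq> B_typical n \<epsilon> p K"
    proof
      fix u assume "u \<in> - {u. g u \<ge> \<epsilon>}"
      then have prob: "measure_pmf.prob (memoryless K u) {vw. (u, map fst vw, map snd vw) \<in> T} \<ge> 1 - \<epsilon>"
        by (simp add: g_compl)
      \<comment> \<open>As \<epsilon> is below 1, the event has positive probability and so contains
        some \<open>vw\<close>; joint typicality with it includes typicality of \<open>u\<close>
        alone.\<close>
      have "{vw. (u, map fst vw, map snd vw) \<in> T} \<noteq> {}"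
      proof
        assume empty: "{vw. (u, map fst vw, map snd vw) \<in> T} = {}"
        show False using prob \<epsilon> unfolding empty by simp
      qed
      moreover have "map_pmf (\<lambda>(x, y, z). x) (joint_pmf p K) = p"
        using map_pmf_joint_pmf_fst[of p K] by (simp add: case_prod_unfold)
      ultimately have "u \<in> typical1 n \<epsilon> p" by (auto simp: T_def typical3_def typical1_def)
      with prob show "u \<in> B_typical n \<epsilon> p K" by (simp add: B_typical_def T_def)
    qed
    have "measure_pmf.prob (replicate_pmf n p) {u. g u \<ge> \<epsilon>}
        \<le> measure_pmf.expectation (replicate_pmf n p) g / \<epsilon>"
      using integral_Markov_inequality_measure[of "replicate_pmf n p" g UNIV \<epsilon>] \<epsilon>
      by (simp add: g_def[abs_def])
    also have "\<dots> \<le> \<epsilon>"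
      using elim \<epsilon> expectation_not_typical[of n p K \<epsilon>]
      by (simp add: g_def[abs_def] T_def divide_le_eq)
    finally have "1 - \<epsilon> \<le> measure_pmf.prob (replicate_pmf n p) (- {u. g u \<ge> \<epsilon>})"
      using measure_pmf.prob_compl[of "{u. g u \<ge> \<epsilon>}" "replicate_pmf n p"]
      by (simp flip: Compl_eq_Diff_UNIV)
    also have "\<dots> \<le> measure_pmf.prob (replicate_pmf n p) (B_typical n \<epsilon> p K)"
      using sub by (intro measure_pmf.finite_measure_mono) auto
    finally show ?case .
  qed
qed

lemma B_typical_subset_seqs:
  assumes "set_pmf p \<subseteq> A"
  shows "B_typical n \<epsilon> p K \<subseteq> seqs n A"
proof
  fix u assume "u \<in> B_typical n \<epsilon> p K"
  then have u: "length u = n" "(\<Prod>i<n. pmf p (u ! i)) > 0"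
    by (auto simp: B_typical_def typical1_def entropy_typical_def)
  then have "pmf p (u ! i) \<noteq> 0" if "i < n" for i
    using that by (metis finite_lessThan lessThan_iff less_irrefl prod_zero)
  then have "u ! i \<in> A" if "i < n" for i using that assms by (auto simp: set_pmf_iff)
  with u(1) show "u \<in> seqs n A" by (auto simp: seqs_def in_set_conv_nth)
qed

lemma finite_seqs: "finite A \<Longrightarrow> finite (seqs n A)"
  using finite_lists_length_eq[of A n] by (simp add: seqs_def conj_commute)

text \<open>Every member is typical and has mass at most
  \<open>2 powr (- n * (H(p) - \<epsilon>))\<close>, so carrying the stated probability takes this
  many members.\<close>

lemma card_B_typical:
  assumes "finite (B_typical n \<epsilon> p K)" and "n > 0"
  shows "measure_pmf.prob (replicate_pmf n p) (B_typical n \<epsilon> p K) * 2 powr (real n * (pmf_entropy p - \<epsilon>))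
    \<le> real (card (B_typical n \<epsilon> p K))"
proof -
  have "measure_pmf.prob (replicate_pmf n p) (B_typical n \<epsilon> p K) =
      (\<Sum>u\<in>B_typical n \<epsilon> p K. pmf (replicate_pmf n p) u)"
    by (rule measure_measure_pmf_finite) (rule assms(1))
  also have "\<dots> \<le> (\<Sum>u\<in>B_typical n \<epsilon> p K. 2 powr (- real n * (pmf_entropy p - \<epsilon>)))"
    using assms(2) by (intro sum_mono entropy_typical_pmf_bounds(2)) (auto simp: B_typical_def typical1_def)
  finally have "measure_pmf.prob (replicate_pmf n p) (B_typical n \<epsilon> p K) * 2 powr (real n * (pmf_entropy p - \<epsilon>)) \<le>
      real (card (B_typical n \<epsilon> p K)) * 2 powr (- real n * (pmf_entropy p - \<epsilon>)) *
      2 powr (real n * (pmf_entropy p - \<epsilon>))" by (intro mult_right_mono) auto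
  also have "\<dots> = real (card (B_typical n \<epsilon> p K))"
    by (simp add: mult.assoc flip: powr_add)
  finally show ?thesis .
qed

section \<open>Random sign coding\<close>

lemma seqs_signs:
  shows finite_seqs_signs: "finite (seqs k signs)" and card_seqs_signs: "card (seqs k signs) = 2 ^ k"
    and seqs_signs_nonempty: "seqs k signs \<noteq> {}"
proof -
  have eq: "seqs k signs = {xs. set xs \<subseteq> signs \<and> length xs = k}" by (auto simp: seqs_def)
  show "finite (seqs k signs)" by (rule finite_seqs) (simp add: signs_def)
  show "card (seqs k signs) = 2 ^ k"
    unfolding eq by (subst card_lists_length_eq) (auto simp: signs_def numeral_2_eq_2)
  then show "seqs k signs \<noteq> {}" by (metis card.empty power_not_zero zero_neq_numeral)
qed

lemma replicate_pmf_signs: "replicate_pmf k (pmf_of_set signs) = pmf_of_set (seqs k signs)"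
proof (rule pmf_eqI)
  fix z
  show "pmf (replicate_pmf k (pmf_of_set signs)) z = pmf (pmf_of_set (seqs k signs)) z"
  proof (cases "z \<in> seqs k signs")
    case True
    then have "(\<Prod>i<k. pmf (pmf_of_set signs) (z ! i)) = (\<Prod>i<k. 1 / 2)"
      by (intro prod.cong refl pmf_signs) (auto simp: seqs_def)
    with True show ?thesis
      by (simp add: pmf_replicate_pmf finite_seqs_signs seqs_signs_nonempty card_seqs_signs)
        (simp add: seqs_def power_divide)
  next
    case False
    then have "z \<notin> set_pmf (replicate_pmf k (pmf_of_set signs))"
      by (auto simp: set_replicate_pmf seqs_def)
    with False show ?thesis
      by (simp add: finite_seqs_signs seqs_signs_nonempty pmf_eq_0_set_pmf)
  qed
qed

text \<open>Fubini for two independent draws, obtained by commuting them.\<close>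

lemma expectation_prob_swap:
  "measure_pmf.expectation p (\<lambda>x. measure_pmf.prob q {y. R x y}) =
   measure_pmf.expectation q (\<lambda>y. measure_pmf.prob p {x. R x y})"
proof -
  have "measure_pmf.expectation p (\<lambda>x. measure_pmf.prob q {y. R x y}) =
      measure_pmf.prob (do {x \<leftarrow> p; y \<leftarrow> q; return_pmf (x, y)}) {(x, y). R x y}"
    by (simp add: prob_bind_pmf[of p] prob_return_pmf_bind)
  also have "\<dots> = measure_pmf.prob (do {y \<leftarrow> q; x \<leftarrow> p; return_pmf (x, y)}) {(x, y). R x y}"
    by (subst bind_commute_pmf) (rule refl)
  also have "\<dots> = measure_pmf.expectation q (\<lambda>y. measure_pmf.prob p {x. R x y})"
    by (simp add: prob_bind_pmf[of q] prob_return_pmf_bind)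
  finally show ?thesis .
qed

text \<open>Used to extract a deterministic code from the random one. The witness lies in the
  support, which guarantees that its sign parts have the right length and alphabet.\<close>

lemma exists_le_expectation_pmf:
  fixes f :: "'a \<Rightarrow> real"
  assumes "integrable (measure_pmf p) f" and "measure_pmf.expectation p f \<le> b"
  obtains x where "x \<in> set_pmf p" "f x \<le> b"
proof (rule ccontr)
  assume "\<not> thesis"
  then have "AE x in measure_pmf p. b < f x" by (meson AE_pmfI not_le that)
  from measure_pmf.expectation_greater[OF assms(1) this] assms(2) show False by simp
qed

lemma prob_Pi_pmf_ex:
  assumes "finite I" "J \<subseteq> I"
  shows "measure_pmf.prob (Pi_pmf I d q) {f. \<exists>k\<in>J. R k (f k)} \<le> (\<Sum>k\<in>J. measure_pmf.prob (q k) {s. R k s})"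
proof -
  have fin: "finite J" using assms by (rule rev_finite_subset)
  have "{f. \<exists>k\<in>J. R k (f k)} = (\<Union>k\<in>J. {f. R k (f k)})" by auto
  then have "measure_pmf.prob (Pi_pmf I d q) {f. \<exists>k\<in>J. R k (f k)} \<le>
      (\<Sum>k\<in>J. measure_pmf.prob (Pi_pmf I d q) {f. R k (f k)})"
    using fin by (simp add: measure_pmf.finite_measure_subadditive_finite)
  also have "\<dots> = (\<Sum>k\<in>J. measure_pmf.prob (q k) {s. R k s})"
  proof (rule sum.cong)
    fix k assume "k \<in> J"
    then have "q k = map_pmf (\<lambda>f. f k) (Pi_pmf I d q)"
      using assms by (subst Pi_pmf_component) auto
    then show "measure_pmf.prob (Pi_pmf I d q) {f. R k (f k)} = measure_pmf.prob (q k) {s. R k s}"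
      by (simp add: prob_map_pmf)
  qed simp
  finally show ?thesis .
qed

text \<open>Isolates the sign part of the transmitted message, so that it can be held fixed while
  the sign parts of the competitors are still random.\<close>

lemma expectation_Pi_pmf_split:
  fixes g :: "('a \<Rightarrow> 'b) \<Rightarrow> real"
  assumes "finite I" "k \<in> I" and g: "\<And>f. \<bar>g f\<bar> \<le> b"
  shows "measure_pmf.expectation (Pi_pmf I d q) g =
    measure_pmf.expectation (q k) (\<lambda>s. measure_pmf.expectation (Pi_pmf (I - {k}) d q) (\<lambda>f. g (f(k := s))))"
proof -
  have "Pi_pmf I d q = do {s \<leftarrow> q k; f \<leftarrow> Pi_pmf (I - {k}) d q; return_pmf (f(k := s))}"
    using Pi_pmf_insert'[of "I - {k}" k d q] assms by (simp add: insert_absorb)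
  then show ?thesis
    by (simp add: integral_bind_pmf_bounded[OF g] flip: map_pmf_def)
qed

text \<open>The entropy condition enters through \<open>slice\<close> alone: for every
  \<open>y\<close> the typical pairs number at most a fraction \<beta> of the
  \<open>2 ^ n\<^sub>2\<close> possible sign parts. This \<beta> becomes the bound on the mean
  probability of confusion.\<close>

locale random_sign_coding =
  fixes W :: "int \<Rightarrow> 'y :: countable pmf" and p :: "int pmf" and \<gamma> \<epsilon> \<beta> :: real and n n\<^sub>1 n\<^sub>2 :: nat
    and amp sg :: "nat \<Rightarrow> int list" and B :: "int list set" and Ma :: nat
  assumes n: "n = n\<^sub>1 + n\<^sub>2" and n\<^sub>1: "n\<^sub>1 = nat \<lfloor>\<gamma> * real n\<rfloor>"
    and B: "B \<subseteq> B_typical n \<epsilon> p (sy_given W)"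
    and amp: "bij_betw amp {1..Ma} B" and Ma: "Ma > 0"
    and sg: "bij_betw sg {1..2 ^ n\<^sub>1} (seqs n\<^sub>1 signs)"
    and slice: "\<And>y. real (card {(a, s) \<in> B \<times> seqs n signs. (a, s, y) \<in> typical3 n \<epsilon> (asy_pmf W p)})
      \<le> \<beta> * 2 ^ n\<^sub>2"
begin

definition enc :: "(nat \<times> nat \<Rightarrow> int list) \<Rightarrow> sc_encoder" where
  "enc c = \<lparr>amp_pmf = p, sgn_frac = \<gamma>, tol = \<epsilon>, num_amp = Ma, amp_seq = amp, sgn_info = sg,
     sgn_code = (\<lambda>ma ms. c (ma, ms))\<rparr>"

definition msgs :: "(nat \<times> nat) set" where
  "msgs = {1..Ma} \<times> {1..2 ^ n\<^sub>1}"

definition T :: "(int list \<times> int list \<times> 'y list) set" where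
  "T = typical3 n \<epsilon> (asy_pmf W p)"

text \<open>The value \<open>[]\<close> is a filler outside \<open>msgs\<close>, where the encoder
  is never consulted.\<close>

definition code :: "(nat \<times> nat \<Rightarrow> int list) pmf" where
  "code = Pi_pmf msgs [] (\<lambda>_. replicate_pmf n\<^sub>2 (pmf_of_set signs))"

definition out :: "nat \<times> nat \<Rightarrow> int list \<Rightarrow> 'y list pmf" where
  "out k s = memoryless W (map2 (*) (amp (fst k)) (sg (snd k) @ s))"

lemma messages_enc: "messages n (enc c) = msgs"
  by (simp add: messages_def msgs_def enc_def num_sgn_def info_len_def flip: n\<^sub>1)

lemma finite_msgs: "finite msgs" and msgs_nonempty: "msgs \<noteq> {}" and card_msgs: "card msgs = Ma * 2 ^ n\<^sub>1"
  using Ma by (auto simp: msgs_def)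

lemma decode_correct:
  assumes k: "k \<in> msgs" and own: "(amp (fst k), sg (snd k) @ c k, y) \<in> T"
    and other: "\<not> (\<exists>l\<in>msgs - {k}. (amp (fst l), sg (snd l) @ c l, y) \<in> T)"
  shows "smd_decode W n (enc c) y = Some k"
proof -
  have "smd_candidates W n (enc c) y = {l \<in> msgs. (amp (fst l), sg (snd l) @ c l, y) \<in> T}"
    by (auto simp: smd_candidates_def messages_enc) (auto simp: sgn_seq_def enc_def T_def)
  also have "\<dots> = {k}" using assms by auto
  finally show ?thesis by (simp add: smd_decode_def)
qed

definition miss :: "nat \<times> nat \<Rightarrow> int list \<Rightarrow> real" where
  "miss k s = measure_pmf.prob (out k s) {y. (amp (fst k), sg (snd k) @ s, y) \<notin> T}"

text \<open>Takes the whole code as argument, whereas \<open>miss\<close> takes only the sign part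
  of the message sent; the two are therefore averaged in different ways.\<close>

definition confuse :: "nat \<times> nat \<Rightarrow> (nat \<times> nat \<Rightarrow> int list) \<Rightarrow> real" where
  "confuse k c = measure_pmf.prob (out k (c k))
     {y. \<exists>l\<in>msgs - {k}. (amp (fst l), sg (snd l) @ c l, y) \<in> T}"

lemma miss_le_1: "\<bar>miss k s\<bar> \<le> 1" and confuse_le_1: "\<bar>confuse k c\<bar> \<le> 1"
  by (simp_all add: miss_def confuse_def)

lemma error_prob_le:
  "error_prob W n (enc c) \<le> (\<Sum>k\<in>msgs. miss k (c k) + confuse k c) / card msgs"
proof -
  have "error_prob W n (enc c) =
      measure_pmf.prob (do {k \<leftarrow> pmf_of_set msgs; y \<leftarrow> out k (c k); return_pmf (k, smd_decode W n (enc c) y)})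
        {(k, d). d \<noteq> Some k}"
    
    unfolding error_prob_def messages_enc
    by (simp add: case_prod_unfold out_def codeword_def sgn_seq_def enc_def)
  also have "\<dots> = (\<Sum>k\<in>msgs. measure_pmf.prob (out k (c k)) {y. smd_decode W n (enc c) y \<noteq> Some k}) / card msgs"
    by (simp add: prob_bind_pmf[of "pmf_of_set msgs"] prob_return_pmf_bind integral_pmf_of_set
        finite_msgs msgs_nonempty)
  also have "\<dots> \<le> (\<Sum>k\<in>msgs. miss k (c k) + confuse k c) / card msgs"
  proof (intro divide_right_mono sum_mono)
    fix k assume k: "k \<in> msgs"
    have "measure_pmf.prob (out k (c k)) {y. smd_decode W n (enc c) y \<noteq> Some k} \<le>
        measure_pmf.prob (out k (c k)) ({y. (amp (fst k), sg (snd k) @ c k, y) \<notin> T} \<union>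
          {y. \<exists>l\<in>msgs - {k}. (amp (fst l), sg (snd l) @ c l, y) \<in> T})"
      using decode_correct[OF k] by (intro measure_pmf.finite_measure_mono subsetI) (simp, blast, simp)
    also have "\<dots> \<le> miss k (c k) + confuse k c"
      unfolding miss_def confuse_def by (rule measure_Un_le) auto
    finally show "measure_pmf.prob (out k (c k)) {y. smd_decode W n (enc c) y \<noteq> Some k}
        \<le> miss k (c k) + confuse k c" .
  qed simp
  finally show ?thesis .
qed

text \<open>Summing over \<open>ms\<close> makes the first \<open>n\<^sub>1\<close> signs uniform,
  since \<open>sg\<close> is a bijection, and the random code makes the other
  \<open>n\<^sub>2\<close> uniform. Signs and output then have exactly the law
  \<open>memoryless (sy_given W) a\<close>, for which the definition of the \<B>-typical set bounds
  the failure probability by \<epsilon>.\<close>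

lemma expectation_miss:
  assumes ma: "ma \<in> {1..Ma}"
  shows "(\<Sum>ms\<in>{1..2 ^ n\<^sub>1}. measure_pmf.expectation (replicate_pmf n\<^sub>2 (pmf_of_set signs)) (miss (ma, ms)))
    \<le> 2 ^ n\<^sub>1 * \<epsilon>"
proof -
  let ?U = "\<lambda>k. replicate_pmf k (pmf_of_set signs)"
  define a where "a = amp ma"
  have aB: "a \<in> B_typical n \<epsilon> p (sy_given W)" using ma amp B by (auto simp: a_def bij_betw_def)
  then have len: "length a = n" by (auto simp: B_typical_def typical1_def entropy_typical_def)
  define \<phi> where "\<phi> s = measure_pmf.prob (memoryless W (map2 (*) a s)) {y. (a, s, y) \<notin> T}" for s
  have \<phi>_le: "\<bar>\<phi> s\<bar> \<le> 1" for s by (simp add: \<phi>_def)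
  have "(\<Sum>ms\<in>{1..2 ^ n\<^sub>1}. measure_pmf.expectation (?U n\<^sub>2) (miss (ma, ms))) / 2 ^ n\<^sub>1 =
      measure_pmf.expectation (pmf_of_set {1..2 ^ n\<^sub>1}) (\<lambda>ms. measure_pmf.expectation (?U n\<^sub>2) (\<lambda>s. \<phi> (sg ms @ s)))"
    by (subst integral_pmf_of_set) (auto simp: miss_def[abs_def] \<phi>_def out_def a_def)
  also have "\<dots> = measure_pmf.expectation (map_pmf sg (pmf_of_set {1..2 ^ n\<^sub>1}))
      (\<lambda>s'. measure_pmf.expectation (?U n\<^sub>2) (\<lambda>s. \<phi> (s' @ s)))" by simp
  also have "map_pmf sg (pmf_of_set {1..2 ^ n\<^sub>1}) = ?U n\<^sub>1"
    unfolding replicate_pmf_signs by (rule map_pmf_of_set_bij_betw[OF sg]) auto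
  also have "measure_pmf.expectation (?U n\<^sub>1) (\<lambda>s'. measure_pmf.expectation (?U n\<^sub>2) (\<lambda>s. \<phi> (s' @ s))) =
      measure_pmf.expectation (?U n) \<phi>"
    by (simp add: n replicate_pmf_distrib integral_bind_pmf_bounded[OF \<phi>_le] flip: map_pmf_def)
  also have "\<dots> = measure_pmf.prob (memoryless (sy_given W) a) {vw. (a, map fst vw, map snd vw) \<notin> T}"
  proof -
    have "measure_pmf.prob (do {y \<leftarrow> memoryless W (map2 (*) a s); return_pmf (zip s y)})
        {vw. (a, map fst vw, map snd vw) \<notin> T} = \<phi> s" if "s \<in> set_pmf (?U n)" for s
      unfolding prob_return_pmf_bind \<phi>_def
    proof (intro measure_pmf.finite_measure_eq_AE AE_pmfI)
      fix y assume "y \<in> set_pmf (memoryless W (map2 (*) a s))"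
      then have "length y = n" "length s = n"
        using len length_replicate_pmf[OF that] by (auto dest!: length_memoryless)
      then show "y \<in> {y. zip s y \<in> {vw. (a, map fst vw, map snd vw) \<notin> T}} \<longleftrightarrow> y \<in> {y. (a, s, y) \<notin> T}"
        by simp
    qed simp_all
    then show ?thesis
      unfolding memoryless_sy_given len prob_bind_pmf[of "?U n"]
      by (intro integral_cong_AE AE_pmfI) auto
  qed
  also have "\<dots> \<le> \<epsilon>"
    using aB measure_pmf.prob_compl[of "{vw. (a, map fst vw, map snd vw) \<in> T}" "memoryless (sy_given W) a"]
    by (simp add: B_typical_def T_def asy_pmf_def Compl_eq flip: Compl_eq_Diff_UNIV)
  finally show ?thesis by (simp add: divide_le_eq mult.commute)
qed

text \<open>The received word is independent of the code words of the competing messages, so for fixed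
  \<open>y\<close> summing over all messages, the transmitted one included, just counts the pairs
  \<open>(a, s)\<close> that are jointly typical with \<open>y\<close>.\<close>

lemma sum_typical_le:
  "(\<Sum>l\<in>msgs. measure_pmf.prob (replicate_pmf n\<^sub>2 (pmf_of_set signs))
      {s. (amp (fst l), sg (snd l) @ s, y) \<in> T}) \<le> \<beta>"
proof -
  define D where "D l = {s \<in> seqs n\<^sub>2 signs. (amp (fst l), sg (snd l) @ s, y) \<in> T}" for l
  have D_fin: "finite (D l)" for l
    by (rule finite_subset[OF _ finite_seqs_signs[of n\<^sub>2]]) (auto simp: D_def)
  have "measure_pmf.prob (replicate_pmf n\<^sub>2 (pmf_of_set signs)) {s. (amp (fst l), sg (snd l) @ s, y) \<in> T} =
      card (D l) / 2 ^ n\<^sub>2" for l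
    unfolding replicate_pmf_signs
    by (subst measure_pmf_of_set) (auto simp: seqs_signs_nonempty finite_seqs_signs card_seqs_signs D_def
        intro!: arg_cong[where f = card])
  then have "(\<Sum>l\<in>msgs. measure_pmf.prob (replicate_pmf n\<^sub>2 (pmf_of_set signs))
      {s. (amp (fst l), sg (snd l) @ s, y) \<in> T}) = card (SIGMA l:msgs. D l) / 2 ^ n\<^sub>2"
    using finite_msgs D_fin by (simp add: card_SigmaI flip: sum_divide_distrib)
  also have "card (SIGMA l:msgs. D l) \<le>
      card {(a, s) \<in> B \<times> seqs n signs. (a, s, y) \<in> typical3 n \<epsilon> (asy_pmf W p)}"
  proof (rule card_inj_on_le[where f = "\<lambda>(l, s). (amp (fst l), sg (snd l) @ s)"])
    \<comment> \<open>All information parts have the same length, so a concatenated sign sequence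
      determines both of its parts.\<close>
    have sg_len: "length (sg ms) = n\<^sub>1" if "ms \<in> {1..2 ^ n\<^sub>1}" for ms
      using sg that by (auto simp: bij_betw_def seqs_def)
    show "inj_on (\<lambda>(l, s). (amp (fst l), sg (snd l) @ s)) (SIGMA l:msgs. D l)"
    proof (rule inj_onI)
      fix x x'
      assume "x \<in> (SIGMA l:msgs. D l)" "x' \<in> (SIGMA l:msgs. D l)"
        and eq: "(\<lambda>(l, s). (amp (fst l), sg (snd l) @ s)) x = (\<lambda>(l, s). (amp (fst l), sg (snd l) @ s)) x'"
      then obtain ma ms s ma' ms' s' where x: "x = ((ma, ms), s)" "x' = ((ma', ms'), s')"
        and l: "(ma, ms) \<in> msgs" "(ma', ms') \<in> msgs" by auto
      have "sg ms = sg ms'" "s = s'" using eq sg_len l by (auto simp: x msgs_def)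
      moreover from this l have "ms = ms'" using sg by (auto simp: msgs_def bij_betw_def dest: inj_onD)
      moreover have "ma = ma'" using eq l amp by (auto simp: x msgs_def bij_betw_def dest: inj_onD)
      ultimately show "x = x'" by (simp add: x)
    qed
    show "(\<lambda>(l, s). (amp (fst l), sg (snd l) @ s)) ` (SIGMA l:msgs. D l) \<subseteq>
        {(a, s) \<in> B \<times> seqs n signs. (a, s, y) \<in> typical3 n \<epsilon> (asy_pmf W p)}"
    proof (rule image_subsetI)
      fix x assume "x \<in> (SIGMA l:msgs. D l)"
      then obtain ma ms s where x: "x = ((ma, ms), s)" and l: "(ma, ms) \<in> msgs" and s: "s \<in> D (ma, ms)"
        by auto
      have "amp ma \<in> B" "sg ms \<in> seqs n\<^sub>1 signs" using l amp sg by (auto simp: msgs_def bij_betw_def)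
      moreover from this s have "sg ms @ s \<in> seqs n signs" by (auto simp: D_def seqs_def n)
      ultimately show "(\<lambda>(l, s). (amp (fst l), sg (snd l) @ s)) x \<in>
          {(a, s) \<in> B \<times> seqs n signs. (a, s, y) \<in> typical3 n \<epsilon> (asy_pmf W p)}"
        using s by (simp add: x D_def T_def)
    qed
    have "finite B" using amp bij_betw_finite by blast
    then show "finite {(a, s) \<in> B \<times> seqs n signs. (a, s, y) \<in> typical3 n \<epsilon> (asy_pmf W p)}"
      by (intro finite_subset[OF _ finite_cartesian_product[OF _ finite_seqs_signs[of n]]]) auto
  qed
  also have "\<dots> \<le> \<beta> * 2 ^ n\<^sub>2" by (rule slice)
  finally show ?thesis by (simp add: divide_le_eq divide_right_mono)
qed

text \<open>Once the sign part \<open>s\<close> of \<open>k\<close> is fixed, the law of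
  \<open>y\<close> no longer involves the other sign parts, so the two draws can be exchanged. For
  each fixed \<open>y\<close> a union bound over the competitors leads to
  \<open>sum_typical_le\<close>.\<close>

lemma expectation_confuse:
  assumes k: "k \<in> msgs"
  shows "measure_pmf.expectation code (confuse k) \<le> \<beta>"
proof -
  let ?U = "replicate_pmf n\<^sub>2 (pmf_of_set signs)"
  let ?F = "Pi_pmf (msgs - {k}) [] (\<lambda>_. ?U)"
  have "measure_pmf.expectation code (confuse k) = measure_pmf.expectation ?U
      (\<lambda>s. measure_pmf.expectation ?F (\<lambda>f. confuse k (f(k := s))))"
    unfolding code_def by (rule expectation_Pi_pmf_split[OF finite_msgs k confuse_le_1])
  also have "\<dots> \<le> measure_pmf.expectation ?U (\<lambda>s. \<beta>)"
  proof (intro expectation_pmf_mono)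
    fix s
    have "measure_pmf.expectation ?F (\<lambda>f. confuse k (f(k := s))) = measure_pmf.expectation ?F
        (\<lambda>f. measure_pmf.prob (out k s) {y. \<exists>l\<in>msgs - {k}. (amp (fst l), sg (snd l) @ f l, y) \<in> T})"
      by (simp add: confuse_def)
    also have "\<dots> = measure_pmf.expectation (out k s)
        (\<lambda>y. measure_pmf.prob ?F {f. \<exists>l\<in>msgs - {k}. (amp (fst l), sg (snd l) @ f l, y) \<in> T})"
      by (rule expectation_prob_swap)
    also have "\<dots> \<le> measure_pmf.expectation (out k s) (\<lambda>y. \<beta>)"
    proof (intro expectation_pmf_mono)
      fix y
      have "measure_pmf.prob ?F {f. \<exists>l\<in>msgs - {k}. (amp (fst l), sg (snd l) @ f l, y) \<in> T} \<le>
          (\<Sum>l\<in>msgs - {k}. measure_pmf.prob ?U {s. (amp (fst l), sg (snd l) @ s, y) \<in> T})"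
        using finite_msgs by (intro prob_Pi_pmf_ex) auto
      \<comment> \<open>Adding the nonnegative term of \<open>k\<close> itself completes the sum to
        all messages.\<close>
      also have "\<dots> \<le> (\<Sum>l\<in>msgs. measure_pmf.prob ?U {s. (amp (fst l), sg (snd l) @ s, y) \<in> T})"
        using finite_msgs by (intro sum_mono2) auto
      also have "\<dots> \<le> \<beta>" by (rule sum_typical_le)
      finally show "measure_pmf.prob ?F {f. \<exists>l\<in>msgs - {k}. (amp (fst l), sg (snd l) @ f l, y) \<in> T} \<le> \<beta>" .
    qed simp_all
    finally show "measure_pmf.expectation ?F (\<lambda>f. confuse k (f(k := s))) \<le> \<beta>" by simp
  next
    have "\<bar>measure_pmf.expectation ?F (\<lambda>f. confuse k (f(k := s)))\<bar> \<le> 1" for s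
    proof -
      have "\<bar>measure_pmf.expectation ?F (\<lambda>f. confuse k (f(k := s)))\<bar> \<le>
          measure_pmf.expectation ?F (\<lambda>f. \<bar>confuse k (f(k := s))\<bar>)" by (rule integral_abs_bound)
      also have "\<dots> \<le> measure_pmf.expectation ?F (\<lambda>f. 1)"
        using confuse_le_1 by (intro expectation_pmf_mono integrable_pmf_bounded[of _ 1]) auto
      finally show ?thesis by simp
    qed
    then show "integrable (measure_pmf ?U) (\<lambda>s. measure_pmf.expectation ?F (\<lambda>f. confuse k (f(k := s))))"
      by (rule integrable_pmf_bounded)
  qed simp
  finally show ?thesis by simp
qed

text \<open>By linearity the mean of the bound in \<open>error_prob_le\<close> is at most \<epsilon>
  + \<beta>, and some code in the support does no worse than the mean.\<close>

lemma good_code: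
  obtains c where "c \<in> set_pmf code" "error_prob W n (enc c) \<le> \<epsilon> + \<beta>"
proof -
  let ?U = "replicate_pmf n\<^sub>2 (pmf_of_set signs)"
  have int: "integrable (measure_pmf code) (\<lambda>c. miss k (c k))" "integrable (measure_pmf code) (confuse k)" for k
    by (rule integrable_pmf_bounded, rule miss_le_1 confuse_le_1)+
  have miss: "measure_pmf.expectation code (\<lambda>c. miss k (c k)) = measure_pmf.expectation ?U (miss k)"
    if "k \<in> msgs" for k
  proof -
    have "?U = map_pmf (\<lambda>c. c k) code"
      unfolding code_def using that finite_msgs by (subst Pi_pmf_component) auto
    then show ?thesis by simp
  qed
  have "(\<Sum>k\<in>msgs. measure_pmf.expectation ?U (miss k)) =
      (\<Sum>ma\<in>{1..Ma}. \<Sum>ms\<in>{1..2 ^ n\<^sub>1}. measure_pmf.expectation ?U (miss (ma, ms)))"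
    unfolding msgs_def by (subst sum.cartesian_product) (simp add: case_prod_unfold)
  also have "\<dots> \<le> (\<Sum>ma\<in>{1..Ma}. 2 ^ n\<^sub>1 * \<epsilon>)"
    by (intro sum_mono expectation_miss)
  also have "\<dots> = card msgs * \<epsilon>" by (simp add: card_msgs)
  finally have sum_miss: "(\<Sum>k\<in>msgs. measure_pmf.expectation ?U (miss k)) \<le> card msgs * \<epsilon>" .
  have card_pos: "0 < real (card msgs)" using finite_msgs msgs_nonempty by (simp add: card_gt_0_iff)
  have "measure_pmf.expectation code (\<lambda>c. (\<Sum>k\<in>msgs. miss k (c k) + confuse k c) / card msgs) =
      (\<Sum>k\<in>msgs. measure_pmf.expectation ?U (miss k) + measure_pmf.expectation code (confuse k)) / card msgs"
    by (simp add: int miss)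
  also have "\<dots> \<le> (card msgs * \<epsilon> + (\<Sum>k\<in>msgs. \<beta>)) / card msgs"
    unfolding sum.distrib
    by (intro divide_right_mono add_mono sum_miss sum_mono expectation_confuse) auto
  also have "\<dots> = \<epsilon> + \<beta>" using card_pos by (simp add: field_simps)
  finally obtain c where "c \<in> set_pmf code" "(\<Sum>k\<in>msgs. miss k (c k) + confuse k c) / card msgs \<le> \<epsilon> + \<beta>"
    using exists_le_expectation_pmf[of code "\<lambda>c. (\<Sum>k\<in>msgs. miss k (c k) + confuse k c) / card msgs" "\<epsilon> + \<beta>"]
      int by auto
  then show thesis by (intro that[of c]) (use error_prob_le[of c] in auto)
qed

lemma valid_enc:
  assumes c: "c \<in> set_pmf code" and p: "set_pmf p \<subseteq> amplitudes M"
    and "0 < \<gamma>" "\<gamma> < 1" "0 < \<epsilon>" "0 < n\<^sub>1"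
  shows "valid_encoder M W n (enc c)"
proof -
  have len: "info_len n (enc c) = n\<^sub>1" by (simp add: info_len_def enc_def flip: n\<^sub>1)
  have "c k \<in> seqs n\<^sub>2 signs" if "k \<in> msgs" for k
  proof -
    have "c \<in> PiE_dflt msgs [] (\<lambda>_. set_pmf (replicate_pmf n\<^sub>2 (pmf_of_set signs)))"
      using c set_Pi_pmf_subset'[OF finite_msgs, of "[]" "\<lambda>_. replicate_pmf n\<^sub>2 (pmf_of_set signs)"]
      by (auto simp: code_def comp_def)
    then have "c k \<in> set_pmf (replicate_pmf n\<^sub>2 (pmf_of_set signs))" using that by (cases k) (auto simp: PiE_dflt_def)
    then show ?thesis by (auto simp: set_replicate_pmf seqs_def)
  qed
  then have "\<forall>(ma, ms) \<in> msgs. sgn_code (enc c) ma ms \<in> seqs (n - n\<^sub>1) signs"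
    by (auto simp: enc_def n)
  moreover have "B \<subseteq> seqs n (amplitudes M)" using B B_typical_subset_seqs[OF p] by blast
  ultimately show ?thesis
    using assms amp sg B Ma unfolding valid_encoder_def len messages_enc num_sgn_def
    by (auto simp: enc_def bij_betw_def)
qed

end

section \<open>Choice of the parameters and passage to the supremum\<close>

lemma finite_amplitudes: "finite (amplitudes M)"
  by (rule finite_subset[of _ "{1..M}"]) (auto simp: amplitudes_def)

lemma feasible_achievable:
  fixes W :: "int \<Rightarrow> 'y :: countable pmf"
  assumes fin: "pmf_finite_entropy (asy_pmf W p)" and feas: "(p, \<gamma>) \<in> feasible M W" and \<delta>: "\<delta> > 0"
  shows "\<forall>\<^sub>F n in sequentially. \<exists>E. valid_encoder M W n E \<and>
    (1 / real n) * log 2 (real (num_amp E * num_sgn n E)) \<ge> pmf_entropy p + \<gamma> - \<delta> \<and>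
    error_prob W n E \<le> \<delta>"
proof -
  define P where "P = asy_pmf W p"
  have p: "set_pmf p \<subseteq> amplitudes M" and \<gamma>: "0 < \<gamma>" "\<gamma> < 1"
    and info: "pmf_entropy p + \<gamma> \<le> info_SA_Y W p"
    using feas by (auto simp: feasible_def)
  \<comment> \<open>The bound by \<delta>/8 keeps the rate loss 4\<epsilon> within \<delta>/2 and
    the error term \<epsilon> below \<delta>/2; the bound by \<gamma>/8 keeps
    \<open>\<gamma>'\<close> positive and, with \<gamma> < 1, puts \<epsilon> below 1/2.\<close>
  define \<epsilon> where "\<epsilon> = min (\<delta> / 8) (\<gamma> / 8)"
  have \<epsilon>: "0 < \<epsilon>" "\<epsilon> < 1 / 2" "8 * \<epsilon> \<le> \<delta>" "8 * \<epsilon> \<le> \<gamma>" using \<delta> \<gamma> by (auto simp: \<epsilon>_def)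
  \<comment> \<open>Two of the three \<epsilon> absorb the slack 2\<epsilon> in
    \<open>card_typical_slice\<close>; the third leaves the exponential decay of \<beta>.\<close>
  define \<gamma>' where "\<gamma>' = \<gamma> - 3 * \<epsilon>"
  have \<gamma>': "0 < \<gamma>'" "\<gamma>' < 1" using \<epsilon> \<gamma> by (auto simp: \<gamma>'_def)
  have cond_entropy: "pmf_entropy P - pmf_entropy (map_pmf (\<lambda>(a, s, y). y) P) \<le> 1 - \<gamma>"
    using info info_SA_Y_eq[OF fin] by (simp add: P_def)
  have "(\<lambda>n. 2 powr (- \<epsilon> * real n)) \<longlonglongrightarrow> 0"
    using \<epsilon>(1) by real_asymp
  then have "\<forall>\<^sub>F n in sequentially. 2 powr (- \<epsilon> * real n) < \<delta> / 2"
    using \<delta> by (intro order_tendstoD(2)) auto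
  moreover have "\<forall>\<^sub>F n in sequentially. 1 - \<epsilon> \<le> measure_pmf.prob (replicate_pmf n p) (B_typical n \<epsilon> p (sy_given W))"
    using fin \<epsilon> by (intro prob_B_typical) (auto simp: asy_pmf_def)
  \<comment> \<open>The summand \<open>1 / \<gamma>'\<close> ensures that at least one sign carries
    information; \<open>4 / \<delta>\<close> makes a total rounding loss of 2 bits at most
    \<open>n * \<delta> / 2\<close>.\<close>
  moreover have "\<forall>\<^sub>F n in sequentially. real n > 1 / \<gamma>' + 4 / \<delta>"
    by (rule eventually_gt_at_top[THEN filterlim_real_sequentially[THEN filterlim_iff[THEN iffD1], rule_format]])
  ultimately show ?thesis
  proof eventually_elim
    case (elim n)
    have n_gt: "real n > 1 / \<gamma>'" "real n > 4 / \<delta>"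
      using elim(3) \<gamma>'(1) \<delta> by (smt (verit) divide_pos_pos)+
    have n_pos: "0 < n" using n_gt(1) \<gamma>'(1) by (cases n) (auto simp: divide_less_0_iff)
    define n\<^sub>1 where "n\<^sub>1 = nat \<lfloor>\<gamma>' * real n\<rfloor>"
    have "1 < \<gamma>' * real n" using n_gt(1) \<gamma>'(1) by (simp add: field_simps)
    then have n\<^sub>1_bounds: "real n\<^sub>1 \<le> \<gamma>' * real n" "\<gamma>' * real n - 1 \<le> real n\<^sub>1" "0 < n\<^sub>1"
      unfolding n\<^sub>1_def by linarith+
    have "\<gamma>' * real n \<le> real n" using \<gamma>' by (intro mult_left_le_one_le) auto
    then have "n\<^sub>1 \<le> n" using n\<^sub>1_bounds(1) by linarith
    define n\<^sub>2 where "n\<^sub>2 = n - n\<^sub>1"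
    have n: "n = n\<^sub>1 + n\<^sub>2" using \<open>n\<^sub>1 \<le> n\<close> by (simp add: n\<^sub>2_def)
    define B where "B = B_typical n \<epsilon> p (sy_given W)"
    have B_fin: "finite B"
      unfolding B_def by (rule finite_subset[OF B_typical_subset_seqs[OF p] finite_seqs[OF finite_amplitudes]])
    define \<beta> where "\<beta> = 2 powr (- \<epsilon> * real n)"
    \<comment> \<open>The exponent loses 1 because the \<B>-typical set is only known to have
      probability at least 1 - \<epsilon>, hence at least 1/2.\<close>
    have card_B: "2 powr (real n * (pmf_entropy p - \<epsilon>) - 1) \<le> real (card B)"
    proof -
      have "2 powr (real n * (pmf_entropy p - \<epsilon>) - 1) = 1 / 2 * 2 powr (real n * (pmf_entropy p - \<epsilon>))"
        by (simp add: powr_diff)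
      also have "\<dots> \<le> measure_pmf.prob (replicate_pmf n p) B * 2 powr (real n * (pmf_entropy p - \<epsilon>))"
        using elim(2) \<epsilon>(2) by (intro mult_right_mono) (auto simp: B_def)
      also have "\<dots> \<le> real (card B)"
        using card_B_typical[of n \<epsilon> p "sy_given W"] B_fin n_pos by (simp add: B_def)
      finally show ?thesis .
    qed
    have B_pos: "0 < card B"
      using card_B by (smt (verit) of_nat_0 gr0I powr_gt_zero)
    obtain amp where amp: "bij_betw amp {1..card B} B"
      using finite_same_card_bij[of "{1..card B}" B] B_fin by auto
    obtain sg where sg: "bij_betw sg {1..2 ^ n\<^sub>1 :: nat} (seqs n\<^sub>1 signs)"
      using finite_same_card_bij[of "{1..2 ^ n\<^sub>1 :: nat}" "seqs n\<^sub>1 signs"]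
      by (auto simp: finite_seqs_signs card_seqs_signs)
    interpret random_sign_coding W p \<gamma>' \<epsilon> \<beta> n n\<^sub>1 n\<^sub>2 amp sg B "card B"
    proof
      fix y
      define F where "F = {(a, s) \<in> B \<times> seqs n signs. (a, s, y) \<in> typical3 n \<epsilon> P}"
      have "finite F"
        by (rule finite_subset[OF _ finite_cartesian_product[OF B_fin finite_seqs_signs[of n]]])
          (auto simp: F_def)
      then have "real (card F) \<le> 2 powr (real n *
          (pmf_entropy P - pmf_entropy (map_pmf (\<lambda>(a, s, y). y) P) + 2 * \<epsilon>))"
        by (rule card_typical_slice) (use n_pos in \<open>auto simp: F_def\<close>)
      also have "\<dots> \<le> 2 powr (real n * (1 - \<gamma> + 2 * \<epsilon>))"
        using cond_entropy by (intro powr_mono mult_left_mono) auto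
      \<comment> \<open>Rounding down \<open>n\<^sub>1\<close> makes \<open>n\<^sub>2\<close> at
        least \<open>n * (1 - \<gamma>')\<close>, which equals
        \<open>n * (1 - \<gamma> + 3 * \<epsilon>)\<close>.\<close>
      also have "\<dots> \<le> 2 powr (- \<epsilon> * real n + real n\<^sub>2)"
        using n\<^sub>1_bounds(1) by (intro powr_mono) (simp_all add: n\<^sub>2_def \<open>n\<^sub>1 \<le> n\<close> of_nat_diff \<gamma>'_def algebra_simps)
      also have "\<dots> = \<beta> * 2 ^ n\<^sub>2" by (simp only: \<beta>_def powr_add) (simp add: powr_realpow)
      finally show "real (card {(a, s) \<in> B \<times> seqs n signs. (a, s, y) \<in> typical3 n \<epsilon> (asy_pmf W p)})
          \<le> \<beta> * 2 ^ n\<^sub>2" by (simp add: F_def P_def)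
    qed (use n amp sg B_pos in \<open>auto simp: n\<^sub>1_def B_def\<close>)
    obtain c where c: "c \<in> set_pmf code" "error_prob W n (enc c) \<le> \<epsilon> + \<beta>"
      by (rule good_code)
    have "valid_encoder M W n (enc c)"
      by (rule valid_enc[OF c(1) p \<gamma>' \<epsilon>(1) n\<^sub>1_bounds(3)])
    moreover have "error_prob W n (enc c) \<le> \<delta>"
      using c(2) elim(1) \<epsilon>(1,3) by (simp add: \<beta>_def)
    moreover have "pmf_entropy p + \<gamma> - \<delta> \<le> (1 / real n) * log 2 (real (num_amp (enc c) * num_sgn n (enc c)))"
    proof -
      \<comment> \<open>The total loss is \<open>4 * n * \<epsilon>\<close> from the exponents plus
        2 bits, one from the probability factor 1/2 and one from the floor in
        \<open>n\<^sub>1\<close>.\<close>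
      have "real n * (pmf_entropy p + \<gamma> - \<delta>) \<le> real n * (pmf_entropy p - \<epsilon>) - 1 + (\<gamma>' * real n - 1)"
      proof -
        have "4 * (real n * \<epsilon>) \<le> real n * \<delta> / 2" using mult_left_mono[OF \<epsilon>(3), of "real n"] by simp
        moreover have "2 \<le> real n * \<delta> / 2" using n_gt(2) \<delta> by (simp add: field_simps)
        ultimately show ?thesis by (simp add: \<gamma>'_def algebra_simps)
      qed
      also have "\<dots> \<le> log 2 (real (card B)) + real n\<^sub>1"
        using card_B B_pos n\<^sub>1_bounds(2) by (intro add_mono) (simp_all add: le_log_iff)
      also have "\<dots> = log 2 (real (card B) * 2 ^ n\<^sub>1)"
        using B_pos by (subst log_mult) (auto simp: log_nat_power)
      also have "\<dots> = log 2 (real (num_amp (enc c) * num_sgn n (enc c)))"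
        by (simp add: enc_def num_sgn_def info_len_def n\<^sub>1_def)
      finally show ?thesis using n_pos by (simp add: field_simps)
    qed
    ultimately show ?case by blast
  qed
qed

theorem theorem2:
  fixes W :: "int \<Rightarrow> 'y :: countable pmf" and m :: nat and M :: int
  assumes "m \<ge> 1" and "M = 2 ^ (m + 1)"
    and finite_entropies:
      "\<And>p. set_pmf p \<subseteq> amplitudes M \<Longrightarrow> pmf_finite_entropy (asy_pmf W p)"
    and "feasible M W \<noteq> {}"
  shows "achievable_smd M W (R_SMD M W)"
  unfolding achievable_smd_def
proof (intro allI impI)
  fix \<delta> :: real assume \<delta>: "\<delta> > 0"
  \<comment> \<open>The supremum need not be attained, so half of \<delta> pays for a nearly optimal
    feasible pair and the other half for achieving its rate.\<close>
  have "R_SMD M W - \<delta> / 2 < (SUP (p, \<gamma>) \<in> feasible M W. pmf_entropy p + \<gamma>)"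
    using \<delta> by (simp add: R_SMD_def)
  then obtain p \<gamma> where feas: "(p, \<gamma>) \<in> feasible M W" and rate: "R_SMD M W - \<delta> / 2 < pmf_entropy p + \<gamma>"
    using less_cSUP_iff[OF assms(4) bdd_above_rates] by auto
  have "pmf_finite_entropy (asy_pmf W p)" using feas finite_entropies by (auto simp: feasible_def)
  then have "\<forall>\<^sub>F n in sequentially. \<exists>E. valid_encoder M W n E \<and>
      pmf_entropy p + \<gamma> - \<delta> / 2 \<le> (1 / real n) * log 2 (real (num_amp E * num_sgn n E)) \<and>
      error_prob W n E \<le> \<delta> / 2"
    using feas \<delta> by (intro feasible_achievable) auto
  then show "\<forall>\<^sub>F n in sequentially. \<exists>E. valid_encoder M W n E \<and>
      R_SMD M W - \<delta> \<le> (1 / real n) * log 2 (real (num_amp E * num_sgn n E)) \<and>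
      error_prob W n E \<le> \<delta>"
  proof (rule eventually_mono)
    fix n
    assume "\<exists>E. valid_encoder M W n E \<and>
      pmf_entropy p + \<gamma> - \<delta> / 2 \<le> (1 / real n) * log 2 (real (num_amp E * num_sgn n E)) \<and>
      error_prob W n E \<le> \<delta> / 2"
    then show "\<exists>E. valid_encoder M W n E \<and>
      R_SMD M W - \<delta> \<le> (1 / real n) * log 2 (real (num_amp E * num_sgn n E)) \<and>
      error_prob W n E \<le> \<delta>"
      using rate \<delta> by (elim ex_forward) linarith
  qed
qed

end
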